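(* Let $\gamma\in(0,1)$, $\varrho>0$, and let the dimension satisfy $d>2/\gamma$. Let $\mu\in\mathcal{M}_{\mathrm{tem}}$ and, for $k>0$, let $\mu_k\in\mathcal{M}_{\mathrm{tem}}$ be the measure with $k^{-d}\mu_k(kB)=\mu(B)$ for all Borel $B\subseteq\mathbb{R}^d$. Start the super-Brownian motion $X=X[\Gamma^1]$ with random catalyst $\Gamma^1$ in $X_0=\mu_k$ (so that the scaled process satisfies $X^k_0=\mu$ for all $k>0$). If $\varkappa\in[0,\varkappa_{\mathrm{c}})$, where $\varkappa_{\mathrm{c}}:=\frac{\gamma d-2}{1+\gamma}$, then for every $t\ge 0$ $$k^{\varkappa}\big(X^k_t-S_t\mu\big)\;\Longrightarrow\;0\quad\text{as }k\uparrow\infty,\ \text{in law with respect to the annealed law }\mathsf{E}\mathbb{P}_{\mu_k},$$ that is, for every $\varphi\in\mathcal{C}_{\exp}$ the real random variables $k^{\varkappa}\langle X_t^k-S_t\mu,\varphi\rangle$ converge to $0$ in law under $\mathsf{E}\mathbb{P}_{\mu_k}$ as $k\uparrow\infty$.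
   Context: Test functions and measures: $\phi_\lambda(x):=e^{-\lambda|x|}$ on $\mathbb{R}^d$. $\mathcal{C}_\lambda$ is the space of continuous $f:\mathbb{R}^d\to\mathbb{R}$ with $\|f/\phi_\lambda\|_\infty<\infty$ such that $f/\phi_\lambda$ has a finite limit as $|x|\to\infty$; $\mathcal{C}_{\exp}:=\bigcup_{\lambda>0}\mathcal{C}_\lambda$, and $\mathcal{C}_{\exp}^+$ is its set of non-negative members. $\mathcal{M}_{\mathrm{tem}}$ is the set of non-negative Radon measures $\mu$ on $\mathbb{R}^d$ with $\langle\mu,\phi_\lambda\rangle:=\int\phi_\lambda\,d\mu<\infty$ for all $\lambda>0$, with the topology in which $\mu_n\to\mu$ iff $\langle\mu_n,\varphi\rangle\to\langle\mu,\varphi\rangle$ for all $\varphi\in\mathcal{C}_{\exp}$. $S=(S_t)_{t\ge0}$ is the semigroup of standard Brownian motion in $\mathbb{R}^d$ (generator $\frac12\Delta$), acting on functions and on measures, so $\langle S_t\mu,\varphi\rangle=\langle\mu,S_t\varphi\rangle$. Catalyst: $\Gamma$ is the stable random measure on $\mathbb{R}^d$ of index $\gamma\in(0,1)$, with law $\mathsf{P}$ (expectation $\mathsf{E}$), determined by $-\log\mathsf{E}\exp(-\langle\Gamma,\varphi\rangle)=\int \varphi^\gamma(z)\,dz$ for $\varphi\in\mathcal{C}_{\exp}^+$. With $\vartheta_1:=\mathsf{1}_{B(0,1)}$ the indicator of the closed unit ball, $\Gamma^1(x):=\int\Gamma(dz)\,\vartheta_1(x-z)$. Reactant: for $\mathsf{P}$-almost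 every sample of $\Gamma$, $X=X[\Gamma^1]=(X,\mathbb{P}_\mu,\mu\in\mathcal{M}_{\mathrm{tem}})$ is the continuous time-homogeneous $\mathcal{M}_{\mathrm{tem}}$-valued Markov process with $-\log\mathbb{E}_\mu\exp(-\langle X_t,\varphi\rangle)=\langle\mu,u(t,\cdot)\rangle$ for $\varphi\in\mathcal{C}_{\exp}^+$, where $u$ is the unique non-negative mild solution of $\partial_tu=\frac12\Delta u-\varrho\,\Gamma^1(x)u^2$, $u(0,\cdot)=\varphi$; here $\varrho>0$ is a fixed constant. $\mathsf{E}\mathbb{P}_{\mu_k}$ denotes the annealed law, i.e. the law $\mathbb{P}_{\mu_k}$ (given $\Gamma$) averaged over $\Gamma$. Scaling: $X^k_t(B):=k^{-d}X_{k^2t}(kB)$ for $t\ge0$, $B\subseteq\mathbb{R}^d$ Borel, $k>0$. *)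

theory Defs
  imports "HOL-Probability.Probability"
begin

section \<open>Test functions and tempered measures\<close>

definition exp_weight :: "real \<Rightarrow> 'a::euclidean_space \<Rightarrow> real" where
  "exp_weight l x = exp (- l * norm x)"

definition C_weighted :: "real \<Rightarrow> ('a::euclidean_space \<Rightarrow> real) set" where
  "C_weighted l = {f. continuous_on UNIV f \<and>
      bounded (range (\<lambda>x. f x / exp_weight l x)) \<and>
      (\<exists>L. ((\<lambda>x. f x / exp_weight l x) \<longlongrightarrow> L) at_infinity)}"

definition C_exp :: "('a::euclidean_space \<Rightarrow> real) set" where
  "C_exp = (\<Union>l\<in>{0<..}. C_weighted l)"

definition C_exp_nonneg :: "('a::euclidean_space \<Rightarrow> real) set" where
  "C_exp_nonneg = {f \<in> C_exp. \<forall>x. 0 \<le> f x}"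

text \<open>The Radon property need not be required separately: integrability of
  \<^term>\<open>exp_weight l\<close> makes a Borel measure finite on compact sets, and such measures on a
  Euclidean space are Radon.\<close>

definition M_tem :: "'a::euclidean_space measure set" where
  "M_tem = {\<mu>. sets \<mu> = sets borel \<and>
      (\<forall>l>0. (\<integral>\<^sup>+ x. ennreal (exp_weight l x) \<partial>\<mu>) < \<infinity>)}"

definition pairing :: "'a::euclidean_space measure \<Rightarrow> ('a \<Rightarrow> real) \<Rightarrow> real" where
  "pairing \<mu> f = (\<integral>x. f x \<partial>\<mu>)"

text \<open>The initial topology of the maps \<open>\<mu> \<mapsto> \<langle>\<mu>, f\<rangle>\<close> with \<open>f\<close> in
  \<^term>\<open>C_exp\<close>, and the Borel \<open>\<sigma>\<close>-algebra it generates.\<close>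

definition M_tem_topology :: "'a::euclidean_space measure topology" where
  "M_tem_topology = topology_generated_by
      {{\<mu> \<in> M_tem. pairing \<mu> f \<in> U} | f U. f \<in> C_exp \<and> open U}"

definition M_tem_algebra :: "'a::euclidean_space measure measure" where
  "M_tem_algebra = sigma M_tem {U. openin M_tem_topology U}"

section \<open>The Brownian semigroup\<close>

definition bm_density :: "real \<Rightarrow> 'a::euclidean_space \<Rightarrow> real" where
  "bm_density t x = (2 * pi * t) powr (- real DIM('a) / 2) * exp (- (norm x)\<^sup>2 / (2 * t))"

definition bm_fun :: "real \<Rightarrow> ('a::euclidean_space \<Rightarrow> real) \<Rightarrow> 'a \<Rightarrow> real" where
  "bm_fun t f x = (if t = 0 then f x else (\<integral>y. bm_density t (y - x) * f y \<partial>lborel))"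

text \<open>By symmetry of the density, this is the adjoint action:
  \<open>\<langle>S\<^sub>t \<mu>, f\<rangle> = \<langle>\<mu>, S\<^sub>t f\<rangle>\<close>.\<close>

definition bm_measure :: "real \<Rightarrow> 'a::euclidean_space measure \<Rightarrow> 'a measure" where
  "bm_measure t \<mu> = (if t = 0 then \<mu>
      else density lborel (\<lambda>x. \<integral>\<^sup>+ y. ennreal (bm_density t (x - y)) \<partial>\<mu>))"

section \<open>The catalyst\<close>

text \<open>The catalyst is taken in canonical form, so \<open>P\<close> is its law on
  \<^term>\<open>M_tem\<close> and the elements of \<^term>\<open>M_tem\<close> are its samples.\<close>

definition stable_random_measure_law :: "real \<Rightarrow> 'a::euclidean_space measure measure \<Rightarrow> bool" where
  "stable_random_measure_law \<gamma> P \<longleftrightarrow>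
      prob_space P \<and> sets P = sets M_tem_algebra \<and>
      (\<forall>\<phi>\<in>C_exp_nonneg.
        - ln (\<integral>G. exp (- pairing G \<phi>) \<partial>P) = (\<integral>z. \<phi> z powr \<gamma> \<partial>lborel))"

definition smoothed_catalyst :: "'a::euclidean_space measure \<Rightarrow> 'a \<Rightarrow> real" where
  "smoothed_catalyst G x = (\<integral>z. indicat_real (cball 0 1) (x - z) \<partial>G)"

section \<open>Super-Brownian motion in a given medium\<close>

text \<open>Mild solutions of \<open>\<partial>\<^sub>t u = \<Delta>u / 2 - \<rho> g u\<^sup>2\<close>, \<open>u(0) = \<phi>\<close>. Only the values
  of \<open>u\<close> at times \<open>t \<ge> 0\<close> matter. For \<open>g \<ge> 0\<close> the integral term is nonnegative,
  so automatically \<open>u(t) \<le> S\<^sub>t \<phi>\<close>.\<close>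

definition mild_solution ::
    "real \<Rightarrow> ('a::euclidean_space \<Rightarrow> real) \<Rightarrow> ('a \<Rightarrow> real) \<Rightarrow> (real \<Rightarrow> 'a \<Rightarrow> real) \<Rightarrow> bool" where
  "mild_solution \<rho> g \<phi> u \<longleftrightarrow>
      (\<forall>t\<ge>0. \<forall>x. 0 \<le> u t x) \<and>
      (\<lambda>(t, x). u t x) \<in> borel_measurable (restrict_space borel {0..} \<Otimes>\<^sub>M borel) \<and>
      (\<forall>t\<ge>0. \<forall>x. u t x = bm_fun t \<phi> x
          - \<rho> * (LINT s:{0..t}|lborel. bm_fun (t - s) (\<lambda>y. g y * (u s y)\<^sup>2) x))"

definition the_mild_solution ::
    "real \<Rightarrow> ('a::euclidean_space \<Rightarrow> real) \<Rightarrow> ('a \<Rightarrow> real) \<Rightarrow> (real \<Rightarrow> 'a \<Rightarrow> real) \<Rightarrow> bool" where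
  "the_mild_solution \<rho> g \<phi> u \<longleftrightarrow>
      mild_solution \<rho> g \<phi> u \<and>
      (\<forall>v. mild_solution \<rho> g \<phi> v \<longrightarrow> (\<forall>t\<ge>0. \<forall>x. v t x = u t x))"

definition paths :: "(real \<Rightarrow> 'a::euclidean_space measure) set" where
  "paths = {w \<in> {0..} \<rightarrow>\<^sub>E M_tem. continuous_map (top_of_set {0..}) M_tem_topology w}"

text \<open>The \<open>\<sigma>\<close>-algebra on path space generated by the coordinates with times in \<open>T\<close>.\<close>

definition path_algebra :: "real set \<Rightarrow> (real \<Rightarrow> 'a::euclidean_space measure) measure" where
  "path_algebra T = sigma paths {{w \<in> paths. w r \<in> A} | r A. r \<in> T \<and> A \<in> sets M_tem_algebra}"

abbreviation path_space :: "(real \<Rightarrow> 'a::euclidean_space measure) measure" where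
  "path_space \<equiv> path_algebra {0..}"

text \<open>A time-homogeneous Markov family in canonical form: \<open>Q \<mu>\<close> is the law on
  path space of the process started in \<open>\<mu>\<close>.\<close>

definition markov_family ::
    "('a::euclidean_space measure \<Rightarrow> (real \<Rightarrow> 'a measure) measure) \<Rightarrow> bool" where
  "markov_family Q \<longleftrightarrow>
      Q \<in> M_tem_algebra \<rightarrow>\<^sub>M prob_algebra path_space \<and>
      (\<forall>\<mu>\<in>M_tem. AE w in Q \<mu>. w 0 = \<mu>) \<and>
      (\<forall>\<mu>\<in>M_tem. \<forall>s\<ge>0. \<forall>t\<ge>0. \<forall>A\<in>sets (path_algebra {0..s}). \<forall>B\<in>sets M_tem_algebra.
        emeasure (Q \<mu>) (A \<inter> {w \<in> paths. w (s + t) \<in> B}) =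
        (\<integral>\<^sup>+ w. emeasure (Q (w s)) {w' \<in> paths. w' t \<in> B} * indicator A w \<partial>Q \<mu>))"

definition super_brownian_motion ::
    "real \<Rightarrow> ('a::euclidean_space \<Rightarrow> real) \<Rightarrow>
     ('a measure \<Rightarrow> (real \<Rightarrow> 'a measure) measure) \<Rightarrow> bool" where
  "super_brownian_motion \<rho> g Q \<longleftrightarrow>
      markov_family Q \<and>
      (\<forall>\<phi>\<in>C_exp_nonneg. \<exists>u. the_mild_solution \<rho> g \<phi> u \<and>
        (\<forall>\<mu>\<in>M_tem. \<forall>t\<ge>0.
          - ln (\<integral>w. exp (- pairing (w t) \<phi>) \<partial>Q \<mu>) = pairing \<mu> (u t)))"

section \<open>Super-Brownian motion in the random medium\<close>

text \<open>\<open>Q G \<mu>\<close> is the law of the process in the medium given by the sample \<open>G\<close>, started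
  in \<open>\<mu>\<close>. Measurability in \<open>G\<close> is what makes the annealed law well defined.\<close>

definition catalytic_sbm ::
    "real \<Rightarrow> 'a::euclidean_space measure measure \<Rightarrow>
     ('a measure \<Rightarrow> 'a measure \<Rightarrow> (real \<Rightarrow> 'a measure) measure) \<Rightarrow> bool" where
  "catalytic_sbm \<rho> P Q \<longleftrightarrow>
      (\<forall>\<mu>\<in>M_tem. (\<lambda>G. Q G \<mu>) \<in> P \<rightarrow>\<^sub>M prob_algebra path_space) \<and>
      (AE G in P. super_brownian_motion \<rho> (smoothed_catalyst G) (Q G))"

definition annealed_law ::
    "'a::euclidean_space measure measure \<Rightarrow>
     ('a measure \<Rightarrow> 'a measure \<Rightarrow> (real \<Rightarrow> 'a measure) measure) \<Rightarrow>
     'a measure \<Rightarrow> (real \<Rightarrow> 'a measure) measure" where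
  "annealed_law P Q \<mu> = P \<bind> (\<lambda>G. Q G \<mu>)"

section \<open>Scaling\<close>

definition rescale :: "real \<Rightarrow> 'a::euclidean_space measure \<Rightarrow> 'a measure" where
  "rescale k \<nu> = scale_measure (ennreal (k powr (- real DIM('a)))) (distr \<nu> borel (\<lambda>x. x /\<^sub>R k))"

lemma emeasure_rescale:
  fixes \<nu> :: "'a::euclidean_space measure"
  assumes "k > 0" "sets \<nu> = sets borel" "B \<in> sets borel"
  shows "emeasure (rescale k \<nu>) B
    = ennreal (k powr (- real DIM('a))) * emeasure \<nu> ((\<lambda>x. k *\<^sub>R x) ` B)"
proof -
  have "(\<lambda>x::'a. x /\<^sub>R k) \<in> \<nu> \<rightarrow>\<^sub>M borel"
    by (subst measurable_cong_sets[OF assms(2) refl]) measurable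
  moreover have "(\<lambda>x::'a. x /\<^sub>R k) -` B \<inter> space \<nu> = (\<lambda>x. k *\<^sub>R x) ` B"
  proof -
    have "x \<in> (\<lambda>x. k *\<^sub>R x) ` B" if "x /\<^sub>R k \<in> B" for x :: 'a
      by (rule image_eqI[of _ _ "x /\<^sub>R k"]) (use assms(1) that in simp_all)
    moreover have "space \<nu> = UNIV"
      using sets_eq_imp_space_eq[OF assms(2)] by simp
    moreover have "(k *\<^sub>R x) /\<^sub>R k = x" for x :: 'a
      using assms(1) by simp
    ultimately show ?thesis by auto
  qed
  ultimately show ?thesis
    using assms(3) by (simp add: rescale_def emeasure_distr)
qed

definition scaled_process ::
    "real \<Rightarrow> (real \<Rightarrow> 'a::euclidean_space measure) \<Rightarrow> real \<Rightarrow> 'a measure" where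
  "scaled_process k w t = rescale k (w (k\<^sup>2 * t))"

definition kappa_crit :: "real \<Rightarrow> nat \<Rightarrow> real" where
  "kappa_crit \<gamma> d = (\<gamma> * real d - 2) / (1 + \<gamma>)"

end

theory Submission
  imports Defs
begin

text \<open>
  Write \<open>T = k\<^sup>2 t\<close> and let \<open>\<psi>\<close> be \<open>k\<^sup>\<kappa>\<^sup>-\<^sup>d \<phi>(x / k)\<close> with \<open>\<phi> \<ge> 0\<close>. The scaled deviation at
  time \<open>t\<close> is \<open>Z = \<langle>X\<^sub>T, \<psi>\<rangle> - \<langle>\<mu>\<^sub>k, S\<^sub>T \<psi>\<rangle>\<close>. In a fixed medium the Laplace functional of \<open>X\<close> yields
  \<open>E (exp (- Z) - 1)\<^sup>2 \<le> exp D - 1\<close>, where \<open>D\<close> is the \<open>\<mu>\<^sub>k\<close>-integral of the loss \<open>S\<^sub>T (2 \<psi>) - u\<^sub>T\<close> of the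
  mild solution \<open>u\<close> with datum \<open>2 \<psi>\<close> (\<open>quenched_deviation_le\<close>). It therefore suffices that a bound for \<open>D\<close>
  has an expectation over the catalyst that tends to 0.

  By the mild equation the loss is \<open>\<rho> \<integral>\<^sub>0\<^sup>T S\<^sub>T\<^sub>-\<^sub>s (\<Gamma>\<^sup>1 u\<^sub>s\<^sup>2) ds\<close>. Bounding \<open>u\<close> by \<open>S \<psi>\<close> throughout is too
  crude: it makes the loss linear in \<open>\<Gamma>\<close>, while \<open>\<Gamma>\<close> has infinite mean, and it ignores that a strong catalyst
  destroys the mass it could act on. Cut \<open>[0, T]\<close> instead into steps of length at most 1. If \<open>F\<close> is a
  multiple of an exponential weight that dominates \<open>S\<^sub>s (2 \<psi>)\<close> for \<open>s \<le> T\<close>, the loss produced in one step at \<open>y\<close> is at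
  most \<open>F y\<close>, because \<open>u \<ge> 0\<close>, and also at most a constant times \<open>(F y)\<^sup>2 \<zeta> y\<close>, where \<open>\<zeta> y\<close> is the pairing of
  \<open>\<Gamma>\<close> with \<open>exp (- |y - z|)\<close>. Hence it is at most \<open>2 F (1 - exp (- C F \<zeta>))\<close> (\<open>absorbed_short_le\<close>). This
  depends on \<open>\<Gamma>\<close> through a Laplace transform, and the stable law gives it expectation of order \<open>F\<^sup>1\<^sup>+\<^sup>\<gamma>\<close>
  (\<open>annealed_saturation_le\<close>).

  The numbers now match: \<open>F\<close> has height of order \<open>k\<^sup>\<kappa>\<^sup>-\<^sup>d\<close> and width of order \<open>k\<close>, the measure \<open>\<mu>\<^sub>k\<close> gives mass of order
  \<open>k\<^sup>d\<close> to that range, and there are about \<open>k\<^sup>2 t\<close> steps. The expected bound is of order \<open>k\<close> to the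
  power \<open>2 + d + (1 + \<gamma>) (\<kappa> - d)\<close> (\<open>deviation_rate\<close>), which is negative precisely when
  \<open>\<kappa> < (\<gamma> d - 2) / (1 + \<gamma>)\<close>. General test functions are split into positive and negative parts.
\<close>

section \<open>The heat semigroup on nonnegative functions\<close>

lemma borel_measurable_bm_density [measurable]:
  fixes f :: "'b \<Rightarrow> 'a::euclidean_space"
  assumes [measurable]: "t \<in> borel_measurable M" "f \<in> borel_measurable M"
  shows "(\<lambda>w. bm_density (t w) (f w)) \<in> borel_measurable M"
  unfolding bm_density_def by measurable

lemma bm_density_nonneg [simp]: "0 \<le> bm_density t x"
  by (simp add: bm_density_def)

lemma nn_integral_lborel_affine:
  fixes f :: "'a::euclidean_space \<Rightarrow> ennreal"
  assumes [measurable]: "f \<in> borel_measurable borel" and c: "c \<noteq> 0"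
  shows "(\<integral>\<^sup>+ x. f x \<partial>lborel) = ennreal (\<bar>c\<bar> ^ DIM('a)) * (\<integral>\<^sup>+ x. f (t + c *\<^sub>R x) \<partial>lborel)"
  by (subst lborel_affine[OF c, of t])
     (simp add: nn_integral_density nn_integral_distr nn_integral_cmult)

lemma nn_integral_lborel_shift:
  fixes f :: "'a::euclidean_space \<Rightarrow> ennreal"
  assumes [measurable]: "f \<in> borel_measurable borel"
  shows "(\<integral>\<^sup>+ x. f (x - t) \<partial>lborel) = (\<integral>\<^sup>+ x. f x \<partial>lborel)"
  using nn_integral_lborel_affine[of f 1 "- t"] by simp

lemma nn_integral_bm_density:
  fixes x :: "'a::euclidean_space"
  assumes t: "0 < t"
  shows "(\<integral>\<^sup>+ y. ennreal (bm_density t (y - x)) \<partial>lborel) = 1"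
proof -
  have c: "(2 * pi * t) powr (- real DIM('a) / 2) = (1 / sqrt (2 * pi * t)) ^ DIM('a)"
  proof -
    have "(2 * pi * t) powr (- real DIM('a) / 2) = ((2 * pi * t) powr (- 1 / 2)) powr real DIM('a)"
      by (subst powr_powr) (simp add: field_simps)
    also have "\<dots> = ((2 * pi * t) powr (- 1 / 2)) ^ DIM('a)"
      using t by (intro powr_realpow) simp
    also have "(2 * pi * t) powr (- 1 / 2) = 1 / sqrt (2 * pi * t)"
      using t by (simp add: powr_minus powr_half_sqrt field_simps)
    finally show ?thesis .
  qed
  \<comment> \<open>The density is a product of one-dimensional normal densities of variance \<open>t\<close>.\<close>
  have p: "bm_density t y = (\<Prod>b\<in>Basis. normal_density 0 (sqrt t) (y \<bullet> b))" for y :: 'a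
  proof -
    have "(norm y)\<^sup>2 = (\<Sum>b\<in>Basis. (y \<bullet> b)\<^sup>2)"
      unfolding power2_norm_eq_inner by (subst euclidean_inner) (simp add: power2_eq_square)
    then have "exp (- (norm y)\<^sup>2 / (2 * t)) = (\<Prod>b\<in>Basis. exp (- (y \<bullet> b)\<^sup>2 / (2 * t)))"
      by (simp add: exp_sum[symmetric] sum_negf sum_divide_distrib)
    then show ?thesis
      unfolding bm_density_def c normal_density_def using t
      by (simp add: prod_dividef power_divide)
  qed
  have "(\<integral>\<^sup>+ y. ennreal (bm_density t (y - x)) \<partial>lborel) = (\<integral>\<^sup>+ y. ennreal (bm_density t (y::'a)) \<partial>lborel)"
    by (rule nn_integral_lborel_shift) measurable
  also have "\<dots> = (\<integral>\<^sup>+ y. (\<Prod>b\<in>Basis. ennreal (normal_density 0 (sqrt t) (y \<bullet> b))) \<partial>(lborel :: 'a measure))"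
    by (simp add: p prod_ennreal)
  also have "\<dots> = (\<Prod>b\<in>(Basis :: 'a set). (\<integral>\<^sup>+ x. ennreal (normal_density 0 (sqrt t) x) \<partial>lborel))"
    by (rule nn_integral_lborel_prod) auto
  also have "(\<integral>\<^sup>+ x. ennreal (normal_density 0 (sqrt t) x) \<partial>lborel) = 1"
    using t by (subst nn_integral_eq_integral) (auto intro!: integrable_normal_density)
  finally show ?thesis by simp
qed

text \<open>Completing the square: a Brownian path from \<open>x\<close> to \<open>z\<close> is at its intermediate time distributed as a
  Gaussian around a point on the segment. This gives the semigroup property from total mass 1 alone.\<close>

lemma bm_density_mult:
  fixes x y z :: "'a::euclidean_space"
  assumes r: "0 < r" and s: "0 < s"
  shows "bm_density r (y - x) * bm_density s (z - y)
    = bm_density (r + s) (z - x) * bm_density (r * s / (r + s)) (y - (s / (r + s)) *\<^sub>R x - (r / (r + s)) *\<^sub>R z)"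
proof -
  define q where "q = r + s"
  have q: "q > 0" "r + s = q" using r s by (auto simp: q_def)
  have e: "(norm (y - x))\<^sup>2 / (2 * r) + (norm (z - y))\<^sup>2 / (2 * s)
    = (norm (z - x))\<^sup>2 / (2 * q) + (norm (y - (s / q) *\<^sub>R x - (r / q) *\<^sub>R z))\<^sup>2 / (2 * (r * s / q))"
  proof -
    have r': "r = q - s" using q by simp
    have ne: "q - s \<noteq> 0" "q \<noteq> 0" "s \<noteq> 0" using r r' q s by auto
    show ?thesis using ne unfolding power2_norm_eq_inner r'
      apply (simp add: inner_diff_left inner_diff_right inner_commute[of y x] inner_commute[of z x] inner_commute[of z y])
      apply (simp add: field_simps)
      done
  qed
  have "(2 * pi * r) * (2 * pi * s) = (2 * pi * q) * (2 * pi * (r * s / q))"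
    using q r s by (simp add: field_simps)
  then have c: "(2 * pi * r) powr a * (2 * pi * s) powr a = (2 * pi * q) powr a * (2 * pi * (r * s / q)) powr a" for a
    using q r s by (simp flip: powr_mult add: mult_ac)
  have "bm_density r (y - x) * bm_density s (z - y) =
    ((2 * pi * r) powr (- real DIM('a) / 2) * (2 * pi * s) powr (- real DIM('a) / 2))
     * exp (- ((norm (y - x))\<^sup>2 / (2 * r) + (norm (z - y))\<^sup>2 / (2 * s)))"
    by (simp add: bm_density_def exp_add[symmetric] exp_diff exp_minus field_simps)
  also have "\<dots> = bm_density q (z - x) * bm_density (r * s / q) (y - (s / q) *\<^sub>R x - (r / q) *\<^sub>R z)"
    unfolding c e by (simp add: bm_density_def exp_add[symmetric] exp_diff exp_minus field_simps)
  finally show ?thesis by (simp add: q)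
qed

text \<open>The Brownian semigroup with values in \<open>[0, \<infinity>]\<close>. Unlike \<^const>\<open>bm_fun\<close>, whose Bochner integral takes
  the value 0 on functions that are not integrable, it commutes, by Tonelli, with integrals over \<open>\<sigma>\<close>-finite measures.\<close>

definition heat :: "real \<Rightarrow> ('a::euclidean_space \<Rightarrow> ennreal) \<Rightarrow> 'a \<Rightarrow> ennreal" where
  "heat t f x = (if t = 0 then f x else (\<integral>\<^sup>+ y. ennreal (bm_density t (y - x)) * f y \<partial>lborel))"

text \<open>Stated for functions and times that depend on a parameter, because below the time variable, the medium
  and the starting point all play that role.\<close>

lemma borel_measurable_heat [measurable (raw)]:
  fixes f :: "'b \<Rightarrow> 'a::euclidean_space \<Rightarrow> ennreal"
  assumes [measurable]: "(\<lambda>(w, y). f w y) \<in> borel_measurable (M \<Otimes>\<^sub>M borel)"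
    and [measurable]: "t \<in> borel_measurable M" "x \<in> borel_measurable M"
  shows "(\<lambda>w. heat (t w) (f w) (x w)) \<in> borel_measurable M"
  unfolding heat_def by measurable

lemma heat_mono: "(\<And>y. f y \<le> g y) \<Longrightarrow> heat t f x \<le> heat t g x"
  by (auto simp: heat_def intro!: nn_integral_mono mult_left_mono)

lemma heat_cmult:
  "f \<in> borel_measurable borel \<Longrightarrow> heat t (\<lambda>y. c * f y) x = c * heat t f x"
  by (auto simp: heat_def nn_integral_cmult[symmetric] mult_ac)

lemma heat_nn_integral:
  fixes f :: "'b \<Rightarrow> 'a::euclidean_space \<Rightarrow> ennreal"
  assumes "sigma_finite_measure M" and [measurable]: "(\<lambda>(w, y). f w y) \<in> borel_measurable (M \<Otimes>\<^sub>M borel)"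
  shows "heat t (\<lambda>y. \<integral>\<^sup>+ w. f w y \<partial>M) x = (\<integral>\<^sup>+ w. heat t (f w) x \<partial>M)"
proof -
  interpret M: sigma_finite_measure M by fact
  interpret pair_sigma_finite M lborel ..
  have "(\<integral>\<^sup>+ y. ennreal (bm_density t (y - x)) * (\<integral>\<^sup>+ w. f w y \<partial>M) \<partial>lborel)
      = (\<integral>\<^sup>+ y. (\<integral>\<^sup>+ w. ennreal (bm_density t (y - x)) * f w y \<partial>M) \<partial>lborel)"
    by (simp add: nn_integral_cmult)
  also have "\<dots> = (\<integral>\<^sup>+ w. (\<integral>\<^sup>+ y. ennreal (bm_density t (y - x)) * f w y \<partial>lborel) \<partial>M)"
    by (rule Fubini') measurable
  finally show ?thesis by (simp add: heat_def)
qed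

lemma heat_heat:
  fixes f :: "'a::euclidean_space \<Rightarrow> ennreal"
  assumes [measurable]: "f \<in> borel_measurable borel" and r: "0 \<le> r" and s: "0 \<le> s"
  shows "heat r (heat s f) x = heat (r + s) f x"
proof (cases "r = 0 \<or> s = 0")
  case True then show ?thesis by (auto simp: heat_def)
next
  case False
  with r s have r: "0 < r" and s: "0 < s" by auto
  have "heat r (heat s f) x =
      (\<integral>\<^sup>+ y. (\<integral>\<^sup>+ z. ennreal (bm_density r (y - x) * bm_density s (z - y)) * f z \<partial>lborel) \<partial>lborel)"
    using r s by (simp add: heat_def nn_integral_cmult[symmetric] ennreal_mult mult.assoc)
  also have "\<dots> = (\<integral>\<^sup>+ z. (\<integral>\<^sup>+ y. ennreal (bm_density r (y - x) * bm_density s (z - y)) * f z \<partial>lborel) \<partial>lborel)"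
    by (rule lborel_pair.Fubini') measurable
  also have "\<dots> = (\<integral>\<^sup>+ z. ennreal (bm_density (r + s) (z - x)) * f z \<partial>lborel)"
  proof (intro nn_integral_cong)
    fix z :: 'a
    have "(\<integral>\<^sup>+ y. ennreal (bm_density r (y - x) * bm_density s (z - y)) * f z \<partial>lborel)
      = (\<integral>\<^sup>+ y. (ennreal (bm_density (r + s) (z - x)) * f z) *
           ennreal (bm_density (r * s / (r + s)) (y - ((s / (r + s)) *\<^sub>R x + (r / (r + s)) *\<^sub>R z))) \<partial>lborel)"
      by (simp add: bm_density_mult[OF r s] ennreal_mult mult_ac diff_diff_eq)
    also have "\<dots> = ennreal (bm_density (r + s) (z - x)) * f z"
      using r s by (subst nn_integral_cmult) (auto simp: nn_integral_bm_density)
    finally show "(\<integral>\<^sup>+ y. ennreal (bm_density r (y - x) * bm_density s (z - y)) * f z \<partial>lborel)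
      = ennreal (bm_density (r + s) (z - x)) * f z" .
  qed
  finally show ?thesis using r s by (simp add: heat_def)
qed

lemma bm_fun_eq_enn2real_heat:
  fixes f :: "'a::euclidean_space \<Rightarrow> real"
  assumes [measurable]: "f \<in> borel_measurable borel" and nn: "\<And>y. 0 \<le> f y"
  shows "bm_fun t f x = enn2real (heat t (\<lambda>y. ennreal (f y)) x)"
proof -
  have "(\<integral>y. bm_density t (y - x) * f y \<partial>lborel) = enn2real (\<integral>\<^sup>+ y. ennreal (bm_density t (y - x) * f y) \<partial>lborel)"
    by (rule integral_eq_nn_integral) (auto simp: nn)
  then show ?thesis by (simp add: bm_fun_def heat_def ennreal_mult nn)
qed

lemma bm_fun_eq_heat:
  fixes f :: "'a::euclidean_space \<Rightarrow> real"
  assumes "f \<in> borel_measurable borel" and "\<And>y. 0 \<le> f y"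
    and "heat t (\<lambda>y. ennreal (f y)) x < \<infinity>"
  shows "ennreal (bm_fun t f x) = heat t (\<lambda>y. ennreal (f y)) x" and "0 \<le> bm_fun t f x"
  using assms by (simp_all add: bm_fun_eq_enn2real_heat)

lemma borel_measurable_bm_fun:
  fixes f :: "'a::euclidean_space \<Rightarrow> real"
  assumes [measurable]: "f \<in> borel_measurable borel" and nn: "\<And>y. 0 \<le> f y"
  shows "bm_fun t f \<in> borel_measurable borel"
proof -
  have "(\<lambda>x. enn2real (heat t (\<lambda>y. ennreal (f y)) x)) \<in> borel_measurable borel" by measurable
  moreover have "bm_fun t f = (\<lambda>x. enn2real (heat t (\<lambda>y. ennreal (f y)) x))"
    by (simp add: fun_eq_iff bm_fun_eq_enn2real_heat nn)
  ultimately show ?thesis by simp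
qed

lemma bm_fun_cmult: "bm_fun t (\<lambda>x. c * f x) x = c * bm_fun t f x"
  by (simp add: bm_fun_def mult.left_commute)

section \<open>Exponential weights under the heat semigroup\<close>

lemma exp_weight_nonneg [simp]: "0 \<le> exp_weight l x"
  by (simp add: exp_weight_def)

lemma borel_measurable_exp_weight [measurable]:
  "f \<in> borel_measurable M \<Longrightarrow> (\<lambda>w. exp_weight l (f w)) \<in> borel_measurable M"
  unfolding exp_weight_def by measurable

text \<open>An exponential moment of a Gaussian is paid for by doubling its variance:
  \<open>l r \<le> r\<^sup>2 / (4 t) + l\<^sup>2 t\<close>.\<close>

lemma bm_density_exp_le:
  fixes v :: "'a::euclidean_space"
  assumes t: "0 < t"
  shows "bm_density t v * exp (l * norm v) \<le> 2 powr (DIM('a) / 2) * exp (l\<^sup>2 * t) * bm_density (2 * t) v"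
proof -
  have "l * norm v \<le> (norm v)\<^sup>2 / (4 * t) + l\<^sup>2 * t"
  proof -
    have "0 \<le> (norm v - 2 * t * l)\<^sup>2 / (4 * t)" using t by simp
    also have "\<dots> = (norm v)\<^sup>2 / (4 * t) + l\<^sup>2 * t - l * norm v"
      using t by (simp add: power2_eq_square field_simps)
    finally show ?thesis by simp
  qed
  then have "exp (- (norm v)\<^sup>2 / (2 * t)) * exp (l * norm v) \<le> exp (l\<^sup>2 * t) * exp (- (norm v)\<^sup>2 / (2 * (2 * t)))"
    unfolding exp_add[symmetric] by (simp add: field_simps)
  moreover have "(2 * pi * t) powr (- real DIM('a) / 2)
      = 2 powr (DIM('a) / 2) * (2 * pi * (2 * t)) powr (- real DIM('a) / 2)"
    using t by (simp add: powr_mult powr_minus field_simps powr_add[symmetric])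
  ultimately show ?thesis
    unfolding bm_density_def by (simp add: mult_ac) (simp add: mult.assoc[symmetric] mult_right_mono)
qed

text \<open>Bounds the growth of an exponential weight of rate \<open>l\<close> over a time \<open>t\<close>, with \<open>a = l\<^sup>2 t\<close>. This combination
  is invariant under Brownian scaling, so the bound is uniform in \<open>k\<close>.\<close>

definition heat_bound :: "'a::euclidean_space itself \<Rightarrow> real \<Rightarrow> real" where
  "heat_bound _ a = 2 powr (DIM('a) / 2) * exp a"

lemma heat_bound_ge_1: "0 \<le> a \<Longrightarrow> 1 \<le> heat_bound TYPE('a::euclidean_space) a"
  using mult_mono[of 1 "2 powr (DIM('a) / 2)" 1 "exp a"]
  by (simp add: heat_bound_def ge_one_powr_ge_zero)

lemma heat_bound_nonneg [simp]: "0 \<le> heat_bound TYPE('a::euclidean_space) a"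
  unfolding heat_bound_def by simp

lemma heat_exp_norm_le:
  fixes x :: "'a::euclidean_space"
  assumes t: "0 \<le> t"
  shows "heat t (\<lambda>y. ennreal (exp (l * norm (y - x)))) x \<le> ennreal (heat_bound TYPE('a) (l\<^sup>2 * t))"
proof (cases "t = 0")
  case True
  then show ?thesis using heat_bound_ge_1[of 0, where 'a='a] by (simp add: heat_def)
next
  case False
  with t have t: "0 < t" by simp
  have "heat t (\<lambda>y. ennreal (exp (l * norm (y - x)))) x
      = (\<integral>\<^sup>+ y. ennreal (bm_density t (y - x) * exp (l * norm (y - x))) \<partial>lborel)"
    using t by (simp add: heat_def ennreal_mult)
  also have "\<dots> \<le> (\<integral>\<^sup>+ y. ennreal (heat_bound TYPE('a) (l\<^sup>2 * t)) * ennreal (bm_density (2 * t) (y - x)) \<partial>lborel)"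
    using bm_density_exp_le[OF t] unfolding heat_bound_def
    by (intro nn_integral_mono) (simp add: ennreal_mult[symmetric] ennreal_leI)
  also have "\<dots> = ennreal (heat_bound TYPE('a) (l\<^sup>2 * t))"
    using t by (subst nn_integral_cmult) (auto simp: nn_integral_bm_density)
  finally show ?thesis .
qed

lemma heat_exp_weight_le:
  fixes x :: "'a::euclidean_space"
  assumes t: "0 \<le> t" and l: "0 \<le> l"
  shows "heat t (\<lambda>y. ennreal (exp_weight l y)) x
    \<le> ennreal (heat_bound TYPE('a) (l\<^sup>2 * t) * exp_weight l x)"
proof -
  have "exp_weight l y \<le> exp_weight l x * exp (l * norm (y - x))" for y
  proof -
    have "norm x \<le> norm y + norm (y - x)" by norm
    then have "l * norm x \<le> l * norm y + l * norm (y - x)"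
      using mult_left_mono[OF _ l] by (fastforce simp: distrib_left)
    then show ?thesis by (simp add: exp_weight_def exp_add[symmetric])
  qed
  then have "heat t (\<lambda>y. ennreal (exp_weight l y)) x
     \<le> heat t (\<lambda>y. ennreal (exp_weight l x) * ennreal (exp (l * norm (y - x)))) x"
    by (intro heat_mono) (simp add: ennreal_mult[symmetric] ennreal_leI exp_weight_def)
  also have "\<dots> = ennreal (exp_weight l x) * heat t (\<lambda>y. ennreal (exp (l * norm (y - x)))) x"
    by (rule heat_cmult) measurable
  also have "\<dots> \<le> ennreal (exp_weight l x) * ennreal (heat_bound TYPE('a) (l\<^sup>2 * t))"
    by (intro mult_left_mono heat_exp_norm_le t) simp
  finally show ?thesis
    by (simp add: ennreal_mult[symmetric] exp_weight_def mult.commute)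
qed

lemma heat_exp_weight_bound_le:
  fixes \<psi> :: "'a::euclidean_space \<Rightarrow> real"
  assumes A: "0 \<le> A" and l: "0 \<le> l" and \<psi>_meas [measurable]: "\<psi> \<in> borel_measurable borel"
    and \<psi>_le: "\<And>x. \<psi> x \<le> A * exp_weight l x"
    and s: "0 \<le> s" "s \<le> T"
  shows "heat s (\<lambda>y. ennreal (\<psi> y)) x \<le> ennreal (A * heat_bound TYPE('a) (l\<^sup>2 * T) * exp_weight l x)"
proof -
  have "heat s (\<lambda>y. ennreal (\<psi> y)) x \<le> heat s (\<lambda>y. ennreal A * ennreal (exp_weight l y)) x"
    using A \<psi>_le by (intro heat_mono) (simp add: ennreal_mult[symmetric] ennreal_leI)
  also have "\<dots> = ennreal A * heat s (\<lambda>y. ennreal (exp_weight l y)) x"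
    by (rule heat_cmult) measurable
  also have "\<dots> \<le> ennreal A * ennreal (heat_bound TYPE('a) (l\<^sup>2 * s) * exp_weight l x)"
    using s l by (intro mult_left_mono heat_exp_weight_le) auto
  also have "\<dots> \<le> ennreal A * ennreal (heat_bound TYPE('a) (l\<^sup>2 * T) * exp_weight l x)"
    using s by (intro mult_left_mono ennreal_leI mult_right_mono) (auto simp: heat_bound_def mult_left_mono)
  finally show ?thesis using A by (simp add: ennreal_mult[symmetric] mult_ac)
qed

lemma bm_fun_exp_weight_le:
  fixes \<psi> :: "'a::euclidean_space \<Rightarrow> real"
  assumes A: "0 \<le> A" and l: "0 \<le> l" and \<psi>_meas [measurable]: "\<psi> \<in> borel_measurable borel"
    and \<psi>_nonneg: "\<And>x. 0 \<le> \<psi> x" and \<psi>_le: "\<And>x. \<psi> x \<le> A * exp_weight l x"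
    and s: "0 \<le> s" "s \<le> T"
  shows "ennreal (bm_fun s \<psi> x) = heat s (\<lambda>y. ennreal (\<psi> y)) x" "0 \<le> bm_fun s \<psi> x"
    "bm_fun s \<psi> x \<le> A * heat_bound TYPE('a) (l\<^sup>2 * T) * exp_weight l x"
proof -
  have fin: "heat s (\<lambda>y. ennreal (\<psi> y)) x < \<infinity>"
    using heat_exp_weight_bound_le[OF A l \<psi>_meas \<psi>_le s, of x] by (simp add: le_less_trans)
  show eq: "ennreal (bm_fun s \<psi> x) = heat s (\<lambda>y. ennreal (\<psi> y)) x" and "0 \<le> bm_fun s \<psi> x"
    using bm_fun_eq_heat[OF \<psi>_meas \<psi>_nonneg fin] by auto
  show "bm_fun s \<psi> x \<le> A * heat_bound TYPE('a) (l\<^sup>2 * T) * exp_weight l x"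
    using heat_exp_weight_bound_le[OF A l \<psi>_meas \<psi>_le s, of x] A unfolding eq[symmetric] by (subst (asm) ennreal_le_iff) auto
qed

section \<open>Test functions and tempered measures\<close>

lemma sets_M_tem: "\<mu> \<in> M_tem \<Longrightarrow> sets \<mu> = sets borel"
  by (simp add: M_tem_def)

lemma space_M_tem: "\<mu> \<in> M_tem \<Longrightarrow> space \<mu> = UNIV"
  using sets_eq_imp_space_eq[OF sets_M_tem] by simp

text \<open>Applied both to test functions and to mild solutions; the latter are only known to be measurable.\<close>

lemma integrable_M_tem:
  fixes f :: "'a::euclidean_space \<Rightarrow> real"
  assumes \<mu>: "\<mu> \<in> M_tem" and f: "f \<in> borel_measurable borel" and l: "0 < l"
    and le: "\<And>x. \<bar>f x\<bar> \<le> C * exp_weight l x"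
  shows "integrable \<mu> f"
proof -
  note [measurable_cong] = sets_M_tem[OF \<mu>]
  have "integrable \<mu> (\<lambda>x. exp_weight l x)"
    using \<mu> l by (intro integrableI_bounded) (auto simp: M_tem_def)
  then have "integrable \<mu> (\<lambda>x. C * exp_weight l x)" by simp
  then show ?thesis
    by (rule Bochner_Integration.integrable_bound) (use f le in \<open>auto intro: order_trans[OF le abs_ge_self]\<close>)
qed

lemma sigma_finite_M_tem:
  fixes \<mu> :: "'a::euclidean_space measure"
  assumes \<mu>: "\<mu> \<in> M_tem"
  shows "sigma_finite_measure \<mu>"
proof
  note [measurable_cong] = sets_M_tem[OF \<mu>]
  \<comment> \<open>On the ball of radius \<open>n\<close> the weight \<open>exp (- norm x)\<close> is at least \<open>exp (- n)\<close>.\<close>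
  have "emeasure \<mu> (cball 0 (real n)) < \<infinity>" for n
  proof -
    have "emeasure \<mu> (cball 0 (real n)) = (\<integral>\<^sup>+ x. indicator (cball 0 (real n)) x \<partial>\<mu>)" by simp
    also have "\<dots> \<le> (\<integral>\<^sup>+ x. ennreal (exp n) * ennreal (exp_weight 1 x) \<partial>\<mu>)"
      by (intro nn_integral_mono)
         (auto simp: indicator_def exp_weight_def ennreal_mult[symmetric] exp_add[symmetric])
    also have "\<dots> < \<infinity>"
      using \<mu> by (subst nn_integral_cmult) (auto simp: M_tem_def ennreal_mult_less_top)
    finally show ?thesis .
  qed
  moreover have "(\<Union>n. cball (0::'a) (real n)) = UNIV"
    using real_arch_simple by (auto simp: dist_norm)
  ultimately show "\<exists>A. countable A \<and> A \<subseteq> sets \<mu> \<and> \<Union>A = space \<mu> \<and> (\<forall>a\<in>A. emeasure \<mu> a \<noteq> \<infinity>)"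
    by (intro exI[of _ "range (\<lambda>n. cball 0 (real n))"]) (auto simp: space_M_tem[OF \<mu>] sets_M_tem[OF \<mu>] less_top)
qed

lemma space_M_tem_algebra: "space M_tem_algebra = M_tem"
  by (simp add: M_tem_algebra_def space_measure_of_conv)

lemma openin_M_tem_subset: "openin M_tem_topology U \<Longrightarrow> U \<subseteq> M_tem"
proof -
  have "topspace M_tem_topology \<subseteq> M_tem"
    unfolding M_tem_topology_def topology_generated_by_topspace by blast
  then show "openin M_tem_topology U \<Longrightarrow> U \<subseteq> M_tem"
    using openin_subset by blast
qed

lemma borel_measurable_pairing:
  assumes f: "f \<in> C_exp"
  shows "(\<lambda>\<mu>. pairing \<mu> f) \<in> borel_measurable M_tem_algebra"
proof (rule borel_measurableI)
  fix U :: "real set" assume "open U"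
  then have "openin M_tem_topology {\<mu> \<in> M_tem. pairing \<mu> f \<in> U}"
    unfolding M_tem_topology_def using f by (intro topology_generated_by_Basis) auto
  then have "{\<mu> \<in> M_tem. pairing \<mu> f \<in> U} \<in> sets M_tem_algebra"
    unfolding M_tem_algebra_def using openin_M_tem_subset
    by (subst sets_measure_of) (auto intro!: sigma_sets.Basic)
  moreover have "(\<lambda>\<mu>. pairing \<mu> f) -` U \<inter> space M_tem_algebra = {\<mu> \<in> M_tem. pairing \<mu> f \<in> U}"
    by (auto simp: space_M_tem_algebra)
  ultimately show "(\<lambda>\<mu>. pairing \<mu> f) -` U \<inter> space M_tem_algebra \<in> sets M_tem_algebra" by simp
qed

lemma pairing_cmult: "pairing \<mu> (\<lambda>x. c * f x) = c * pairing \<mu> f"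
  by (simp add: pairing_def)

lemma C_exp_borel: "f \<in> C_exp \<Longrightarrow> f \<in> borel_measurable borel"
  by (auto simp: C_exp_def C_weighted_def intro: borel_measurable_continuous_onI)

lemma C_exp_bound:
  assumes "f \<in> C_exp"
  obtains A l where "0 \<le> A" "0 < l" "\<And>x. \<bar>f x\<bar> \<le> A * exp_weight l x"
proof -
  obtain l where l: "0 < l" "bounded (range (\<lambda>x. f x / exp_weight l x))"
    using assms by (auto simp: C_exp_def C_weighted_def)
  then obtain A where A: "\<And>x. \<bar>f x / exp_weight l x\<bar> \<le> A"
    by (auto simp: bounded_iff)
  have "0 \<le> A" using A[of 0] by (meson abs_ge_zero order_trans)
  moreover have "\<bar>f x\<bar> \<le> A * exp_weight l x" for x
    using A[of x] by (simp add: exp_weight_def abs_divide divide_le_eq)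
  ultimately show ?thesis using that l(1) by blast
qed

lemma integrable_C_exp:
  assumes \<mu>: "\<mu> \<in> M_tem" and f: "f \<in> C_exp"
  shows "integrable \<mu> f"
proof -
  obtain A l where "0 < l" "\<And>x. \<bar>f x\<bar> \<le> A * exp_weight l x" using C_exp_bound[OF f] by blast
  then show ?thesis using integrable_M_tem[OF \<mu> C_exp_borel[OF f]] by blast
qed

lemma C_weightedI:
  fixes f :: "'a::euclidean_space \<Rightarrow> real"
  assumes "continuous_on UNIV f" "\<And>x. \<bar>f x\<bar> \<le> C * exp_weight l x"
    "((\<lambda>x. f x / exp_weight l x) \<longlongrightarrow> L) at_infinity"
  shows "f \<in> C_weighted l"
proof -
  have "bounded (range (\<lambda>x. f x / exp_weight l x))"
    using assms(2) by (intro boundedI[of _ C]) (auto simp: exp_weight_def field_simps)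
  then show ?thesis using assms unfolding C_weighted_def by blast
qed

lemma C_exp_mult:
  assumes "f \<in> C_exp"
  shows "(\<lambda>x. c * f x) \<in> C_exp"
proof -
  obtain l where l: "0 < l" "f \<in> C_weighted l" using assms by (auto simp: C_exp_def)
  from l(2) obtain L where f: "continuous_on UNIV f" "bounded (range (\<lambda>x. f x / exp_weight l x))"
      "((\<lambda>x. f x / exp_weight l x) \<longlongrightarrow> L) at_infinity"
    by (auto simp: C_weighted_def)
  from f(2) have "bounded ((\<lambda>x. c *\<^sub>R x) ` range (\<lambda>x. f x / exp_weight l x))"
    by (rule bounded_scaling)
  then have "bounded (range (\<lambda>x. c * f x / exp_weight l x))" by (simp add: image_image)
  moreover have "((\<lambda>x. c * f x / exp_weight l x) \<longlongrightarrow> c * L) at_infinity"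
    using tendsto_mult[OF tendsto_const[of c] f(3)] by simp
  ultimately have "(\<lambda>x. c * f x) \<in> C_weighted l"
    using f(1) by (auto simp: C_weighted_def intro!: continuous_intros)
  then show ?thesis using l(1) by (auto simp: C_exp_def)
qed

lemma C_exp_dilate:
  fixes f :: "'a::euclidean_space \<Rightarrow> real"
  assumes "f \<in> C_exp" and k: "0 < k"
  shows "(\<lambda>x. f (x /\<^sub>R k)) \<in> C_exp"
proof -
  obtain l where l: "0 < l" "f \<in> C_weighted l" using assms by (auto simp: C_exp_def)
  from l(2) obtain L where f: "continuous_on UNIV f" "bounded (range (\<lambda>x. f x / exp_weight l x))"
      "((\<lambda>x. f x / exp_weight l x) \<longlongrightarrow> L) at_infinity"
    by (auto simp: C_weighted_def)
  have w: "exp_weight (l / k) x = exp_weight l (x /\<^sub>R k)" for x :: 'a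
    using k by (simp add: exp_weight_def field_simps)
  have "bounded (range (\<lambda>x. f (x /\<^sub>R k) / exp_weight (l / k) x))"
    unfolding w by (rule bounded_subset[OF f(2)]) auto
  moreover have "((\<lambda>x. f (x /\<^sub>R k) / exp_weight (l / k) x) \<longlongrightarrow> L) at_infinity"
  proof -
    have "filterlim (\<lambda>x::'a. x /\<^sub>R k) at_infinity at_infinity"
      unfolding filterlim_at_infinity_conv_norm_at_top
    proof -
      have "filterlim (\<lambda>x::'a. inverse k * norm x) at_top at_infinity"
        using k by (intro filterlim_tendsto_pos_mult_at_top[OF tendsto_const _ filterlim_norm_at_top]) simp
      then show "filterlim (\<lambda>x::'a. norm (x /\<^sub>R k)) at_top at_infinity"
        using k by (simp add: abs_of_pos)
    qed
    from filterlim_compose[OF f(3) this] show ?thesis unfolding w .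
  qed
  moreover have "continuous_on UNIV (\<lambda>x. f (x /\<^sub>R k))"
    using continuous_on_compose2[OF f(1), of UNIV "\<lambda>x. x /\<^sub>R k"] by (simp add: continuous_intros)
  ultimately have "(\<lambda>x. f (x /\<^sub>R k)) \<in> C_weighted (l / k)"
    by (auto simp: C_weighted_def)
  then show ?thesis using l(1) k unfolding C_exp_def by (intro UN_I[of "l / k"]) auto
qed

lemma C_exp_max_0:
  assumes "f \<in> C_exp"
  shows "(\<lambda>x. max 0 (f x)) \<in> C_exp_nonneg"
proof -
  obtain l where l: "0 < l" "f \<in> C_weighted l" using assms by (auto simp: C_exp_def)
  from l(2) obtain L where f: "continuous_on UNIV f" "bounded (range (\<lambda>x. f x / exp_weight l x))"
      "((\<lambda>x. f x / exp_weight l x) \<longlongrightarrow> L) at_infinity"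
    by (auto simp: C_weighted_def)
  have w: "max 0 (f x) / exp_weight l x = max 0 (f x / exp_weight l x)" for x
    by (simp add: max_def exp_weight_def divide_le_0_iff zero_le_divide_iff)
  obtain B where B: "\<And>x. \<bar>f x / exp_weight l x\<bar> \<le> B" using f(2) by (auto simp: bounded_iff)
  have "bounded (range (\<lambda>x. max 0 (f x) / exp_weight l x))"
  proof (rule boundedI)
    fix z assume "z \<in> range (\<lambda>x. max 0 (f x) / exp_weight l x)"
    then obtain x where z: "z = max 0 (f x / exp_weight l x)" unfolding w by auto
    have "norm (max 0 y) \<le> B" if "\<bar>y\<bar> \<le> B" for y :: real
      using that by (auto simp: max_def)
    then show "norm z \<le> B" unfolding z by this (rule B)
  qed
  moreover have "((\<lambda>x. max 0 (f x) / exp_weight l x) \<longlongrightarrow> max 0 L) at_infinity"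
    unfolding w by (intro tendsto_max tendsto_const f(3))
  ultimately have "(\<lambda>x. max 0 (f x)) \<in> C_weighted l"
    using f(1) by (auto simp: C_weighted_def intro!: continuous_intros)
  then show ?thesis using l(1) by (auto simp: C_exp_nonneg_def C_exp_def)
qed

section \<open>The exponential potential of the catalyst\<close>

text \<open>Up to a constant, a continuous majorant of the smoothed catalyst. It is the pairing of \<open>G\<close> with an admissible test function, so its
  Laplace transform is known, and at neighbouring points its values are comparable.\<close>

definition exp_potential :: "'a::euclidean_space measure \<Rightarrow> 'a \<Rightarrow> real" where
  "exp_potential G y = pairing G (\<lambda>z. exp (- norm (y - z)))"

lemma integrable_exp_potential:
  assumes "G \<in> M_tem"
  shows "integrable G (\<lambda>z. exp (- norm (y - z)))"
proof (rule integrable_M_tem[OF assms, where l=1 and C="exp (norm y)"])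
  fix z have "norm z \<le> norm y + norm (y - z)" by norm
  then show "\<bar>exp (- norm (y - z))\<bar> \<le> exp (norm y) * exp_weight 1 z"
    by (simp add: exp_weight_def exp_add[symmetric])
qed auto

lemma exp_potential_nonneg [simp]: "0 \<le> exp_potential G y"
  by (simp add: exp_potential_def pairing_def)

lemma exp_potential_le:
  assumes "G \<in> M_tem"
  shows "exp_potential G w \<le> exp (norm (w - y)) * exp_potential G y"
proof -
  have "exp (- norm (w - z)) \<le> exp (norm (w - y)) * exp (- norm (y - z))" for z
  proof -
    have "norm (y - z) \<le> norm (w - y) + norm (w - z)" by norm
    then show ?thesis by (simp add: exp_add[symmetric])
  qed
  then show ?thesis
    unfolding exp_potential_def pairing_def integral_mult_right_zero[symmetric]
    by (intro integral_mono integrable_mult_right integrable_exp_potential assms)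
qed

lemma borel_measurable_smoothed_catalyst:
  assumes "G \<in> M_tem"
  shows "smoothed_catalyst G \<in> borel_measurable borel"
proof -
  interpret sigma_finite_measure G by (rule sigma_finite_M_tem[OF assms])
  note [measurable_cong] = sets_M_tem[OF assms]
  have [measurable]: "indicat_real (cball (0::'a) 1) \<in> borel_measurable borel"
    by (intro borel_measurable_indicator borel_closed closed_cball)
  show ?thesis unfolding smoothed_catalyst_def
    by (intro borel_measurable_lebesgue_integral) measurable
qed

lemma smoothed_catalyst_nonneg [simp]: "0 \<le> smoothed_catalyst G y"
  by (simp add: smoothed_catalyst_def)

lemma smoothed_catalyst_le:
  assumes G: "G \<in> M_tem"
  shows "smoothed_catalyst G y \<le> exp 1 * exp_potential G y"
  unfolding smoothed_catalyst_def exp_potential_def pairing_def integral_mult_right_zero[symmetric]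
proof (rule integral_mono')
  show "integrable G (\<lambda>z. exp 1 * exp (- norm (y - z)))"
    by (intro integrable_mult_right integrable_exp_potential G)
qed (auto simp: indicator_def exp_add[symmetric])

text \<open>By comparability of the exponential potential at neighbouring points, averaging the catalyst over a bounded time
  reproduces the potential up to a constant. The small rate \<open>l\<close> lets the weight be frozen at \<open>y\<close> as well.\<close>

lemma heat_catalyst_le:
  fixes G :: "'a::euclidean_space measure"
  assumes G: "G \<in> M_tem" and r: "0 \<le> r" "r \<le> R" and l: "0 \<le> l" "l \<le> 1 / 2"
  shows "heat r (\<lambda>w. ennreal (smoothed_catalyst G w * (exp_weight l w)\<^sup>2)) y
    \<le> ennreal (exp 1 * heat_bound TYPE('a) (4 * R) * exp_potential G y * (exp_weight l y)\<^sup>2)"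
proof -
  let ?c = "exp 1 * exp_potential G y * (exp_weight l y)\<^sup>2"
  \<comment> \<open>Moving from \<open>w\<close> to \<open>y\<close> costs \<open>exp (norm (w - y))\<close> for the potential, and at most as much again
    for the squared weight because \<open>2 l \<le> 1\<close>.\<close>
  have "smoothed_catalyst G w * (exp_weight l w)\<^sup>2 \<le> ?c * exp (2 * norm (w - y))" for w
  proof -
    have a: "smoothed_catalyst G w \<le> exp 1 * (exp (norm (w - y)) * exp_potential G y)"
      using smoothed_catalyst_le[OF G, of w] exp_potential_le[OF G, of w y] by (meson exp_ge_zero mult_left_mono order_trans)
    have "norm y \<le> norm w + norm (w - y)" by norm
    then have "2 * l * norm y \<le> 2 * l * norm w + 2 * l * norm (w - y)"
      using mult_left_mono[of _ _ "2 * l"] l by (fastforce simp: distrib_left)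
    also have "\<dots> \<le> 2 * l * norm w + norm (w - y)"
      using l by (simp add: mult_left_le_one_le)
    finally have b: "(exp_weight l w)\<^sup>2 \<le> exp (norm (w - y)) * (exp_weight l y)\<^sup>2"
      by (simp add: exp_weight_def power2_eq_square exp_add[symmetric])
    have "smoothed_catalyst G w * (exp_weight l w)\<^sup>2 \<le>
        (exp 1 * (exp (norm (w - y)) * exp_potential G y)) * (exp (norm (w - y)) * (exp_weight l y)\<^sup>2)"
      by (rule mult_mono[OF a b]) auto
    also have "\<dots> = ?c * (exp (norm (w - y)) * exp (norm (w - y)))"
      by (simp add: mult_ac)
    also have "exp (norm (w - y)) * exp (norm (w - y)) = exp (2 * norm (w - y))"
      by (simp add: exp_add[symmetric])
    finally show ?thesis .
  qed
  then have "heat r (\<lambda>w. ennreal (smoothed_catalyst G w * (exp_weight l w)\<^sup>2)) y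
      \<le> heat r (\<lambda>w. ennreal ?c * ennreal (exp (2 * norm (w - y)))) y"
    by (intro heat_mono) (simp add: ennreal_mult[symmetric] ennreal_leI)
  also have "\<dots> = ennreal ?c * heat r (\<lambda>w. ennreal (exp (2 * norm (w - y)))) y"
    by (rule heat_cmult) measurable
  also have "\<dots> \<le> ennreal ?c * ennreal (heat_bound TYPE('a) (2\<^sup>2 * r))"
    by (intro mult_left_mono heat_exp_norm_le r) simp
  also have "\<dots> \<le> ennreal ?c * ennreal (heat_bound TYPE('a) (4 * R))"
    using r by (intro mult_left_mono ennreal_leI) (auto simp: heat_bound_def)
  finally show ?thesis by (simp add: ennreal_mult[symmetric] mult_ac)
qed

lemma exp_norm_diff_in_C_exp:
  fixes y :: "'a::euclidean_space"
  assumes "0 \<le> c"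
  shows "(\<lambda>z. c * exp (- norm (y - z))) \<in> C_exp_nonneg"
proof -
  \<comment> \<open>At rate 1 the quotient by the weight need not converge at infinity; at any smaller rate it tends to 0.\<close>
  have le: "exp (- norm (y - z)) / exp_weight (1/2) z \<le> exp (norm y) * exp (- (norm z / 2))" for z
  proof -
    have "norm z \<le> norm y + norm (y - z)" by norm
    then have "- norm (y - z) - - (1/2) * norm z \<le> norm y + - (norm z / 2)" by simp
    then show ?thesis unfolding exp_weight_def exp_add[symmetric] exp_diff[symmetric] exp_le_cancel_iff .
  qed
  have "((\<lambda>z::'a. exp (norm y) * exp (- (norm z / 2))) \<longlongrightarrow> exp (norm y) * 0) at_infinity"
  proof (intro tendsto_mult tendsto_const)
    have "filterlim (\<lambda>z::'a. 1 / 2 * norm z) at_top at_infinity"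
      by (rule filterlim_tendsto_pos_mult_at_top[OF tendsto_const _ filterlim_norm_at_top]) simp
    then have "filterlim (\<lambda>z::'a. - (norm z / 2)) at_bot at_infinity"
      unfolding filterlim_uminus_at_bot by simp
    then show "((\<lambda>z::'a. exp (- (norm z / 2))) \<longlongrightarrow> 0) at_infinity"
      by (rule filterlim_compose[OF exp_at_bot])
  qed
  then have g: "((\<lambda>z::'a. exp (norm y) * exp (- (norm z / 2))) \<longlongrightarrow> 0) at_infinity"
    by simp
  have "((\<lambda>z. exp (- norm (y - z)) / exp_weight (1/2) z) \<longlongrightarrow> 0) at_infinity"
    by (rule tendsto_sandwich[OF always_eventually always_eventually tendsto_const g])
       (use le in \<open>simp_all add: exp_weight_def\<close>)
  then have "((\<lambda>z. c * (exp (- norm (y - z)) / exp_weight (1/2) z)) \<longlongrightarrow> c * 0) at_infinity"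
    by (intro tendsto_mult tendsto_const)
  then have lim: "((\<lambda>z. c * exp (- norm (y - z)) / exp_weight (1/2) z) \<longlongrightarrow> 0) at_infinity"
    by simp
  have "(\<lambda>z. c * exp (- norm (y - z))) \<in> C_weighted (1/2)"
  proof (rule C_weightedI[OF _ _ lim])
    show "continuous_on UNIV (\<lambda>z. c * exp (- norm (y - z)))" by (intro continuous_intros)
    fix z
    have "exp (- norm (y - z)) \<le> exp (norm y) * exp_weight (1/2) z"
    proof -
      have "norm z \<le> norm y + norm (y - z)" by norm
      then show ?thesis using norm_ge_zero[of z] norm_ge_zero[of y]
        unfolding exp_weight_def exp_add[symmetric] exp_le_cancel_iff by linarith
    qed
    then show "\<bar>c * exp (- norm (y - z))\<bar> \<le> (c * exp (norm y)) * exp_weight (1/2) z"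
      using assms by (simp add: abs_mult mult_left_mono mult.assoc)
  qed
  then show ?thesis
    using assms unfolding C_exp_nonneg_def C_exp_def UN_iff mem_Collect_eq
    by (intro conjI bexI[of _ "1/2"] allI) simp_all
qed

lemma tendsto_exp_potential:
  assumes G: "G \<in> M_tem" and X: "X \<longlonglongrightarrow> y"
  shows "(\<lambda>n. exp_potential G (X n)) \<longlonglongrightarrow> exp_potential G y"
proof (rule tendsto_sandwich[where f="\<lambda>n. exp (- norm (X n - y)) * exp_potential G y"
      and h="\<lambda>n. exp (norm (X n - y)) * exp_potential G y"])
  have n: "(\<lambda>n. norm (X n - y)) \<longlonglongrightarrow> 0"
    using X by (simp add: LIM_zero_iff tendsto_norm_zero)
  have "(\<lambda>n. exp (norm (X n - y)) * exp_potential G y) \<longlonglongrightarrow> exp 0 * exp_potential G y"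
      "(\<lambda>n. exp (- norm (X n - y)) * exp_potential G y) \<longlonglongrightarrow> exp (- 0) * exp_potential G y"
    by (intro tendsto_exp tendsto_mult tendsto_minus tendsto_const n)+
  then show "(\<lambda>n. exp (norm (X n - y)) * exp_potential G y) \<longlonglongrightarrow> exp_potential G y"
      "(\<lambda>n. exp (- norm (X n - y)) * exp_potential G y) \<longlonglongrightarrow> exp_potential G y"
    by simp_all
  show "\<forall>\<^sub>F n in sequentially. exp_potential G (X n) \<le> exp (norm (X n - y)) * exp_potential G y"
    by (intro always_eventually allI exp_potential_le G)
  show "\<forall>\<^sub>F n in sequentially. exp (- norm (X n - y)) * exp_potential G y \<le> exp_potential G (X n)"
  proof (intro always_eventually allI)
    fix n
    show "exp (- norm (X n - y)) * exp_potential G y \<le> exp_potential G (X n)"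
      using exp_potential_le[OF G, of y "X n"] by (simp add: exp_minus field_simps norm_minus_commute)
  qed
qed

lemma borel_measurable_exp_potential_pair:
  "(\<lambda>(G, y). exp_potential G y) \<in> borel_measurable (M_tem_algebra \<Otimes>\<^sub>M (borel :: 'a::euclidean_space measure))"
proof -
  obtain F where F: "\<And>i. simple_function borel (F i :: 'a \<Rightarrow> 'a)" "\<And>x. (\<lambda>i. F i x) \<longlonglongrightarrow> x"
    using borel_measurable_implies_sequence_metric[of "\<lambda>x::'a. x" borel] by simp blast
  \<comment> \<open>\<open>F i\<close> takes finitely many values, so only measurability in \<open>G\<close> at fixed points is needed.\<close>
  have 1: "(\<lambda>w. exp_potential (fst w) (F i (snd w))) \<in> borel_measurable (M_tem_algebra \<Otimes>\<^sub>M (borel :: 'a measure))" for i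
  proof (rule measurable_compose_countable'[where g="\<lambda>w. F i (snd w)" and I="range (F i)" and f="\<lambda>z w. exp_potential (fst w) z"])
    fix z :: 'a
    have "(\<lambda>z'. 1 * exp (- norm (z - z'))) \<in> C_exp"
      using exp_norm_diff_in_C_exp[of 1 z] by (simp add: C_exp_nonneg_def)
    then have "(\<lambda>G. exp_potential G z) \<in> borel_measurable M_tem_algebra"
      unfolding exp_potential_def using borel_measurable_pairing[of "\<lambda>z'. exp (- norm (z - z'))"] by simp
    then show "(\<lambda>w. exp_potential (fst w) z) \<in> borel_measurable (M_tem_algebra \<Otimes>\<^sub>M (borel :: 'a measure))"
      by (rule measurable_compose[OF measurable_fst])
  next
    have fin: "finite (range (F i))" using F(1)[of i] by (simp add: simple_function_def)
    then show "countable (range (F i))" by (rule countable_finite)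
    have "F i \<in> borel \<rightarrow>\<^sub>M count_space (range (F i))"
      using F(1)[of i] fin unfolding measurable_count_space_eq2[OF fin] by (auto simp: simple_function_def)
    from measurable_compose[OF measurable_snd this]
    show "(\<lambda>w. F i (snd w)) \<in> (M_tem_algebra \<Otimes>\<^sub>M (borel :: 'a measure)) \<rightarrow>\<^sub>M count_space (range (F i))" .
  qed
  have "(\<lambda>w. exp_potential (fst w) (snd w)) \<in> borel_measurable (M_tem_algebra \<Otimes>\<^sub>M (borel :: 'a measure))"
  proof (rule borel_measurable_LIMSEQ_real[OF _ 1])
    fix w :: "'a measure \<times> 'a" assume "w \<in> space (M_tem_algebra \<Otimes>\<^sub>M borel)"
    then have "fst w \<in> M_tem" by (auto simp: space_pair_measure space_M_tem_algebra)
    then show "(\<lambda>i. exp_potential (fst w) (F i (snd w))) \<longlonglongrightarrow> exp_potential (fst w) (snd w)"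
      by (rule tendsto_exp_potential[OF _ F(2)])
  qed
  then show ?thesis by (simp add: case_prod_beta)
qed

text \<open>The form in which joint measurability is used: composed with measurable maps, and for any law
  \<open>P\<close> on the space of media. It permits exchanging the expectation over the medium with space integrals.\<close>

lemma borel_measurable_exp_potential_joint:
  fixes g :: "'w \<Rightarrow> 'a::euclidean_space"
  assumes P: "sets P = sets M_tem_algebra" and "f \<in> M \<rightarrow>\<^sub>M P" and [measurable]: "g \<in> borel_measurable M"
  shows "(\<lambda>w. exp_potential (f w) (g w)) \<in> borel_measurable M"
proof -
  have [measurable]: "f \<in> M \<rightarrow>\<^sub>M M_tem_algebra"
    using assms(2) measurable_cong_sets[OF refl P] by blast
  have "(\<lambda>w. (f w, g w)) \<in> M \<rightarrow>\<^sub>M M_tem_algebra \<Otimes>\<^sub>M borel" by measurable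
  from measurable_compose[OF this borel_measurable_exp_potential_pair] show ?thesis by simp
qed

section \<open>Loss of mass in a fixed medium\<close>

text \<open>Replaces the truncation \<open>min 1 q\<close> by a function whose expectation over the catalyst is a Laplace transform.\<close>

lemma min_1_le_exp:
  fixes q :: real
  assumes "0 \<le> q"
  shows "min 1 q \<le> 2 * (1 - exp (- q))"
proof -
  have "exp (- q) \<le> 1 / (1 + q)"
    using exp_ge_add_one_self[of q] assms by (simp add: exp_minus field_simps)
  moreover have "min 1 q \<le> 2 * (1 - 1 / (1 + q))"
    using assms mult_nonneg_nonneg[OF assms assms] mult_left_le[of q q] by (cases "q \<le> 1") (auto simp: min_def field_simps)
  ultimately show ?thesis by simp
qed

text \<open>Up to the factor \<open>\<rho>\<close>, the contribution of the times in \<open>[a, b]\<close> to the difference between \<open>S\<^sub>\<tau> \<psi>\<close>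
  and the mild solution at time \<open>\<tau>\<close>.\<close>

definition absorbed ::
    "'a::euclidean_space measure \<Rightarrow> (real \<Rightarrow> 'a \<Rightarrow> real) \<Rightarrow> real \<Rightarrow> real \<Rightarrow> real \<Rightarrow> 'a \<Rightarrow> ennreal" where
  "absorbed G u a b \<tau> x = (\<integral>\<^sup>+ s. indicator {a..b} s *
      heat (\<tau> - s) (\<lambda>y. ennreal (smoothed_catalyst G y * (u s y)\<^sup>2)) x \<partial>lborel)"

text \<open>In this part a medium \<open>G\<close> and a mild solution \<open>u\<close> are fixed. The assumption \<open>l \<le> 1 / 2\<close> says that the
  datum varies slowly on the unit scale of the catalyst.\<close>

context
  fixes G :: "'a::euclidean_space measure" and \<psi> :: "'a \<Rightarrow> real" and u :: "real \<Rightarrow> 'a \<Rightarrow> real"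
    and \<rho> A l T :: real
  assumes G: "G \<in> M_tem" and mild: "mild_solution \<rho> (smoothed_catalyst G) \<psi> u"
    and \<rho>: "0 \<le> \<rho>" and A: "0 \<le> A" and l: "0 < l" "l \<le> 1 / 2" and T: "0 \<le> T"
    and \<psi>_meas [measurable]: "\<psi> \<in> borel_measurable borel"
    and \<psi>_nonneg: "\<And>x. 0 \<le> \<psi> x"
    and \<psi>_le: "\<And>x. \<psi> x \<le> A * exp_weight l x"
begin

declare borel_measurable_smoothed_catalyst[OF G, measurable]

abbreviation (input) "envelope \<equiv> \<lambda>x :: 'a. A * heat_bound TYPE('a) (l\<^sup>2 * T) * exp_weight l x"
abbreviation (input) "absorption s \<equiv> \<lambda>y. smoothed_catalyst G y * (u s y)\<^sup>2"

lemma mild_eq: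
  "0 \<le> t \<Longrightarrow> u t x = bm_fun t \<psi> x - \<rho> * (LINT s:{0..t}|lborel. bm_fun (t - s) (absorption s) x)"
  and u_nonneg: "0 \<le> t \<Longrightarrow> 0 \<le> u t x"
  and u_meas: "(\<lambda>(t, x). u t x) \<in> borel_measurable (restrict_space borel {0..} \<Otimes>\<^sub>M borel)"
  using mild by (auto simp: mild_solution_def)

lemma u_max_meas [measurable]: "(\<lambda>(t, x). u (max 0 t) x) \<in> borel_measurable (borel \<Otimes>\<^sub>M borel)"
proof -
  have "(\<lambda>(t, x). (max 0 t, x)) \<in> (borel \<Otimes>\<^sub>M borel) \<rightarrow>\<^sub>M (restrict_space borel {0::real..} \<Otimes>\<^sub>M (borel :: 'a measure))"
    unfolding case_prod_beta by (intro measurable_Pair measurable_restrict_space2) auto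
  from measurable_compose[OF this u_meas] show ?thesis by (simp add: case_prod_beta)
qed

lemmas bm_fun_initial = bm_fun_exp_weight_le[OF A less_imp_le[OF l(1)] \<psi>_meas \<psi>_nonneg \<psi>_le]

text \<open>Whatever the value of the integral term, it is nonnegative.\<close>

lemma u_le_bm_fun: "0 \<le> t \<Longrightarrow> u t x \<le> bm_fun t \<psi> x"
proof -
  assume t: "0 \<le> t"
  have "0 \<le> (LINT s:{0..t}|lborel. bm_fun (t - s) (absorption s) x)"
    unfolding set_lebesgue_integral_def
    by (intro integral_nonneg_AE AE_I2) (auto simp: bm_fun_def indicator_def intro!: integral_nonneg_AE)
  then show ?thesis using mild_eq[OF t, of x] \<rho> by simp
qed

text \<open>Besides its quantitative use, this shows that all integrals in the mild equation are finite, so that it can be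
  read as an equation between nonnegative extended reals.\<close>

lemma heat_absorption_le:
  assumes "0 \<le> s" "s \<le> T" "0 \<le> r" "r \<le> R"
  shows "heat r (\<lambda>y. ennreal (absorption s y)) x
    \<le> ennreal (exp 1 * heat_bound TYPE('a) (4 * R) * exp_potential G x * (envelope x)\<^sup>2)"
proof -
  let ?B = "(A * heat_bound TYPE('a) (l\<^sup>2 * T))\<^sup>2"
  have "absorption s y \<le> ?B * (smoothed_catalyst G y * (exp_weight l y)\<^sup>2)" for y
  proof -
    have "(u s y)\<^sup>2 \<le> (envelope y)\<^sup>2"
      using u_nonneg[of s y] u_le_bm_fun[of s y] bm_fun_initial(3)[where s=s and x=y and T=T] assms
      by (intro power_mono) auto
    then have "absorption s y \<le> smoothed_catalyst G y * (envelope y)\<^sup>2"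
      by (intro mult_left_mono) auto
    then show ?thesis by (simp add: power_mult_distrib mult_ac)
  qed
  then have "heat r (\<lambda>y. ennreal (absorption s y)) x
      \<le> heat r (\<lambda>y. ennreal ?B * ennreal (smoothed_catalyst G y * (exp_weight l y)\<^sup>2)) x"
    by (intro heat_mono) (simp add: ennreal_mult[symmetric] ennreal_leI)
  also have "\<dots> = ennreal ?B * heat r (\<lambda>y. ennreal (smoothed_catalyst G y * (exp_weight l y)\<^sup>2)) x"
    by (intro heat_cmult) measurable
  also have "\<dots> \<le> ennreal ?B * ennreal (exp 1 * heat_bound TYPE('a) (4 * R) * exp_potential G x * (exp_weight l x)\<^sup>2)"
    using assms l by (intro mult_left_mono heat_catalyst_le[OF G]) auto
  finally show ?thesis
    by (simp add: ennreal_mult[symmetric] power_mult_distrib mult_ac)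
qed

lemma absorbed_alt:
  "0 \<le> a \<Longrightarrow> absorbed G u a b \<tau> x =
    (\<integral>\<^sup>+ s. indicator {a..b} s * heat (\<tau> - s) (absorption (max 0 s)) x \<partial>lborel)"
  unfolding absorbed_def by (intro nn_integral_cong) (auto simp: indicator_def)

lemma absorbed_meas: "0 \<le> a \<Longrightarrow> absorbed G u a b \<tau> \<in> borel_measurable borel"
proof -
  assume "0 \<le> a"
  then have "absorbed G u a b \<tau> =
      (\<lambda>x. \<integral>\<^sup>+ s. indicator {a..b} s * heat (\<tau> - s) (absorption (max 0 s)) x \<partial>lborel)"
    by (simp add: fun_eq_iff absorbed_alt)
  then show ?thesis by simp measurable
qed

lemma absorbed_mono: "a' \<le> a \<Longrightarrow> b \<le> b' \<Longrightarrow> absorbed G u a b \<tau> x \<le> absorbed G u a' b' \<tau> x"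
  unfolding absorbed_def by (intro nn_integral_mono) (auto simp: indicator_def)

lemma absorbed_le:
  assumes "0 \<le> a" "a \<le> b" "b \<le> \<tau>" "\<tau> \<le> T" "\<tau> \<le> a + R"
  shows "absorbed G u a b \<tau> x
    \<le> ennreal ((b - a) * (exp 1 * heat_bound TYPE('a) (4 * R) * exp_potential G x * (envelope x)\<^sup>2))"
proof -
  let ?c = "exp 1 * heat_bound TYPE('a) (4 * R) * exp_potential G x * (envelope x)\<^sup>2"
  have "absorbed G u a b \<tau> x \<le> (\<integral>\<^sup>+ s. ennreal ?c * indicator {a..b} s \<partial>lborel)"
    unfolding absorbed_def
    by (intro nn_integral_mono) (use assms in \<open>auto simp: indicator_def intro!: heat_absorption_le\<close>)
  also have "\<dots> = ennreal ?c * ennreal (b - a)"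
    using assms by (subst nn_integral_cmult) auto
  finally show ?thesis
    using assms by (simp add: ennreal_mult[symmetric] mult_ac)
qed

lemma absorbed_mild_eq:
  assumes \<tau>: "0 \<le> \<tau>" "\<tau> \<le> T"
  shows "ennreal \<rho> * absorbed G u 0 \<tau> \<tau> x = ennreal (bm_fun \<tau> \<psi> x - u \<tau> x)"
proof -
  let ?f = "\<lambda>s. indicator {0..\<tau>} s *\<^sub>R bm_fun (\<tau> - s) (absorption s) x"
  have fin: "absorbed G u 0 \<tau> \<tau> x < \<infinity>"
    using absorbed_le[of 0 \<tau> \<tau> T x] \<tau> by (simp add: le_less_trans)
  have f: "ennreal (?f s) = indicator {0..\<tau>} s * heat (\<tau> - s) (absorption (max 0 s)) x" "0 \<le> ?f s" for s
  proof -
    have "ennreal (bm_fun (\<tau> - s) (absorption s) x) = heat (\<tau> - s) (absorption (max 0 s)) x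
        \<and> 0 \<le> bm_fun (\<tau> - s) (absorption s) x" if s: "0 \<le> s" "s \<le> \<tau>"
    proof -
      have [measurable]: "absorption s \<in> borel_measurable borel"
      proof -
        have "absorption (max 0 s) \<in> borel_measurable borel" by measurable
        then show ?thesis using s by simp
      qed
      have "heat (\<tau> - s) (absorption s) x < \<infinity>"
        using heat_absorption_le[of s "\<tau> - s" T x] s \<tau> by (simp add: le_less_trans)
      from bm_fun_eq_heat[OF _ _ this] s show ?thesis by simp
    qed
    then show "ennreal (?f s) = indicator {0..\<tau>} s * heat (\<tau> - s) (absorption (max 0 s)) x" "0 \<le> ?f s"
      by (auto simp: indicator_def)
  qed
  have "?f = (\<lambda>s. enn2real (indicator {0..\<tau>} s * heat (\<tau> - s) (absorption (max 0 s)) x))"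
    unfolding f(1)[symmetric] using f(2) by (simp add: fun_eq_iff)
  moreover have "(\<lambda>s. enn2real (indicator {0..\<tau>} s * heat (\<tau> - s) (absorption (max 0 s)) x)) \<in> borel_measurable lborel"
    by measurable
  ultimately have "(\<integral>s. ?f s \<partial>lborel) = enn2real (\<integral>\<^sup>+ s. ennreal (?f s) \<partial>lborel)"
    using f(2) by (intro integral_eq_nn_integral) auto
  also have "(\<integral>\<^sup>+ s. ennreal (?f s) \<partial>lborel) = absorbed G u 0 \<tau> \<tau> x"
    unfolding f(1) by (simp add: absorbed_alt)
  finally have "bm_fun \<tau> \<psi> x - u \<tau> x = \<rho> * enn2real (absorbed G u 0 \<tau> \<tau> x)"
    using mild_eq[OF \<tau>(1), of x] by (simp add: set_lebesgue_integral_def)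
  then show ?thesis
    using \<rho> fin by (simp add: ennreal_mult)
qed

text \<open>Absorption up to time \<open>b\<close>, carried to a later time \<open>\<tau>\<close> by the semigroup property.\<close>

lemma absorbed_heat:
  assumes "0 \<le> a" "b \<le> \<tau>"
  shows "absorbed G u a b \<tau> x = heat (\<tau> - b) (absorbed G u a b b) x"
proof -
  have *: "heat (\<tau> - b) (heat (b - s) (absorption (max 0 s))) x = heat (\<tau> - s) (absorption (max 0 s)) x"
    if "s \<le> b" for s
    using heat_heat[of "absorption (max 0 s)" "\<tau> - b" "b - s" x] assms that by simp
  have "absorbed G u a b b = (\<lambda>x. \<integral>\<^sup>+ s. indicator {a..b} s * heat (b - s) (absorption (max 0 s)) x \<partial>lborel)"
    by (simp add: fun_eq_iff absorbed_alt assms)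
  then have "heat (\<tau> - b) (absorbed G u a b b) x =
      (\<integral>\<^sup>+ s. heat (\<tau> - b) (\<lambda>y. indicator {a..b} s * heat (b - s) (absorption (max 0 s)) y) x \<partial>lborel)"
    by (simp only:) (rule heat_nn_integral[OF lborel.sigma_finite_measure_axioms], measurable)
  also have "\<dots> = (\<integral>\<^sup>+ s. indicator {a..b} s * heat (\<tau> - b) (heat (b - s) (absorption (max 0 s))) x \<partial>lborel)"
    by (intro nn_integral_cong heat_cmult) measurable
  also have "\<dots> = (\<integral>\<^sup>+ s. indicator {a..b} s * heat (\<tau> - s) (absorption (max 0 s)) x \<partial>lborel)"
    by (intro nn_integral_cong) (simp add: indicator_def *)
  finally show ?thesis by (simp add: absorbed_alt[OF assms(1)])
qed

text \<open>The key estimate. During a step of length at most 1 the absorption is bounded in two ways: by the datum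
  itself, since the solution stays nonnegative, and quadratically in the datum, by neglecting that the solution is depleted.
  Taking the smaller of the two caps the effect of a strong catalyst.\<close>

lemma absorbed_short_le:
  assumes "0 \<le> a" "a \<le> b" "b \<le> T" "b \<le> a + 1"
  shows "ennreal \<rho> * absorbed G u a b b y \<le> ennreal (2 * envelope y *
    (1 - exp (- (exp 1 * heat_bound TYPE('a) 4 * \<rho> * envelope y * exp_potential G y))))"
proof -
  let ?q = "exp 1 * heat_bound TYPE('a) 4 * \<rho> * envelope y * exp_potential G y"
  have q: "0 \<le> ?q" and E: "0 \<le> envelope y" using A \<rho> by auto
  have "ennreal \<rho> * absorbed G u a b b y \<le> ennreal \<rho> * absorbed G u 0 b b y"
    using assms by (intro mult_left_mono absorbed_mono) auto
  also have "\<dots> = ennreal (bm_fun b \<psi> y - u b y)"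
    using assms by (intro absorbed_mild_eq) auto
  also have "\<dots> \<le> ennreal (envelope y)"
    using bm_fun_initial(3)[where s=b and x=y and T=T] u_nonneg[of b y] assms by (intro ennreal_leI) auto
  finally have 1: "ennreal \<rho> * absorbed G u a b b y \<le> ennreal (envelope y)" .
  have "ennreal \<rho> * absorbed G u a b b y
      \<le> ennreal \<rho> * ennreal ((b - a) * (exp 1 * heat_bound TYPE('a) 4 * exp_potential G y * (envelope y)\<^sup>2))"
    using absorbed_le[of a b b 1 y] assms by (intro mult_left_mono) auto
  also have "\<dots> \<le> ennreal \<rho> * ennreal (1 * (exp 1 * heat_bound TYPE('a) 4 * exp_potential G y * (envelope y)\<^sup>2))"
    using assms by (intro mult_left_mono ennreal_leI mult_right_mono) auto
  also have "\<dots> = ennreal (envelope y * ?q)"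
    using \<rho> A by (subst ennreal_mult[symmetric]) (auto simp: power2_eq_square mult_ac)
  finally have "ennreal \<rho> * absorbed G u a b b y \<le> ennreal (min (envelope y) (envelope y * ?q))"
    using 1 by (auto simp: min_def)
  also have "min (envelope y) (envelope y * ?q) = envelope y * min 1 ?q"
    using E mult_left_mono[OF _ E, of ?q 1] mult_left_mono[OF _ E, of 1 ?q] by (auto simp: min_def intro: antisym)
  also have "ennreal \<dots> \<le> ennreal (envelope y * (2 * (1 - exp (- ?q))))"
    using E q by (intro ennreal_leI mult_left_mono min_1_le_exp) auto
  finally show ?thesis by (simp only: mult_ac)
qed

text \<open>The time interval is cut into \<open>N\<close> steps of length at most 1. The short time estimate is applied to each, and
  what happens afterwards is bounded by the free heat flow.\<close>

lemma loss_le: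
  fixes N :: nat
  assumes N: "0 < N" "T \<le> real N"
  shows "ennreal (bm_fun T \<psi> x - u T x) \<le> (\<Sum>n<N. heat (T - real (Suc n) * (T / N)) (\<lambda>y. ennreal (2 * envelope y *
    (1 - exp (- (exp 1 * heat_bound TYPE('a) 4 * \<rho> * envelope y * exp_potential G y))))) x)"
proof -
  define h where "h = T / N"
  have h: "0 \<le> h" "h \<le> 1" "T = real N * h" using N T by (auto simp: h_def)
  have le: "real (Suc n) * h \<le> T" if "n < N" for n
    unfolding h(3) by (intro mult_right_mono h) (use that in linarith)
  have cover: "indicator {0..T} s \<le> (\<Sum>n<N. indicator {real n * h..real (Suc n) * h} s :: ennreal)" for s
  proof (cases "s \<in> {0..T}")
    case True
    have "\<exists>n<N. s \<in> {real n * h..real (Suc n) * h}"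
    proof (cases "h = 0")
      case True then show ?thesis using \<open>s \<in> {0..T}\<close> N h by auto
    next
      case False
      with h have h0: "0 < h" by simp
      show ?thesis
      proof (cases "s = T")
        case True
        then show ?thesis using N h h0 by (intro exI[of _ "N - 1"]) (auto simp: of_nat_diff algebra_simps)
      next
        case False
        define n where "n = nat \<lfloor>s / h\<rfloor>"
        have "real n \<le> s / h" "s / h < real n + 1"
          using True h0 unfolding n_def by (auto simp: le_floor_iff)
        then have n: "real n * h \<le> s" "s \<le> real (Suc n) * h"
          using h0 by (auto simp: field_simps)
        moreover have "real n * h < real N * h" using n(1) False True h by auto
        then have "n < N" using h0 by simp
        ultimately show ?thesis by auto
      qed
    qed
    then obtain n where n: "n < N" "s \<in> {real n * h..real (Suc n) * h}" by auto
    have "indicator {0..T} s = (indicator {real n * h..real (Suc n) * h} s :: ennreal)"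
      using n True by simp
    also have "\<dots> \<le> (\<Sum>n<N. indicator {real n * h..real (Suc n) * h} s)"
      using n(1) by (intro member_le_sum) auto
    finally show ?thesis .
  qed simp
  \<comment> \<open>An inequality is enough, so the common end points of adjacent steps do no harm (for \<open>T = 0\<close> all
    steps coincide).\<close>
  have "absorbed G u 0 T T x \<le> (\<integral>\<^sup>+ s. (\<Sum>n<N. indicator {real n * h..real (Suc n) * h} s) *
      heat (T - s) (absorption (max 0 s)) x \<partial>lborel)"
    unfolding absorbed_alt[OF order_refl] by (intro nn_integral_mono mult_right_mono cover) simp
  also have "\<dots> = (\<Sum>n<N. absorbed G u (real n * h) (real (Suc n) * h) T x)"
    unfolding sum_distrib_right
    using h(1) by (subst nn_integral_sum) (measurable, simp add: absorbed_alt)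
  finally have "ennreal (bm_fun T \<psi> x - u T x)
      \<le> ennreal \<rho> * (\<Sum>n<N. absorbed G u (real n * h) (real (Suc n) * h) T x)"
    unfolding absorbed_mild_eq[OF T order_refl, symmetric] by (intro mult_left_mono) auto
  also have "\<dots> = (\<Sum>n<N. ennreal \<rho> * heat (T - real (Suc n) * h) (absorbed G u (real n * h) (real (Suc n) * h) (real (Suc n) * h)) x)"
    unfolding sum_distrib_left using h le by (intro sum.cong refl arg_cong2[where f="(*)"] absorbed_heat) auto
  also have "\<dots> = (\<Sum>n<N. heat (T - real (Suc n) * h) (\<lambda>y. ennreal \<rho> * absorbed G u (real n * h) (real (Suc n) * h) (real (Suc n) * h) y) x)"
    using h by (intro sum.cong refl heat_cmult[symmetric] absorbed_meas) auto
  also have "\<dots> \<le> (\<Sum>n<N. heat (T - real (Suc n) * h) (\<lambda>y. ennreal (2 * envelope y *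
    (1 - exp (- (exp 1 * heat_bound TYPE('a) 4 * \<rho> * envelope y * exp_potential G y))))) x)"
    using h le by (intro sum_mono heat_mono absorbed_short_le) (auto simp: algebra_simps)
  finally show ?thesis unfolding h_def .
qed

end

section \<open>Average loss over the catalyst\<close>

text \<open>Positivity matters because the laws are specified through \<open>- ln\<close> of such expectations, and
  \<^const>\<open>ln\<close> can be inverted at positive arguments only.\<close>

lemma (in prob_space) expectation_exp_neg:
  fixes X :: "'a \<Rightarrow> real"
  assumes X: "X \<in> borel_measurable M" and nn: "\<And>w. w \<in> space M \<Longrightarrow> 0 \<le> X w"
  shows "integrable M (\<lambda>w. exp (- X w))" "0 < (\<integral>w. exp (- X w) \<partial>M)"
proof -
  show i: "integrable M (\<lambda>w. exp (- X w))"
    using X nn by (intro integrable_const_bound[where B=1]) (auto intro!: AE_I2)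
  show "0 < (\<integral>w. exp (- X w) \<partial>M)"
  proof (rule ccontr)
    assume "\<not> 0 < (\<integral>w. exp (- X w) \<partial>M)"
    moreover have "0 \<le> (\<integral>w. exp (- X w) \<partial>M)"
      by (rule Bochner_Integration.integral_nonneg) simp
    ultimately have "(\<integral>w. exp (- X w) \<partial>M) = 0" by linarith
    then have "AE w in M. exp (- X w) = 0"
      using integral_nonneg_eq_0_iff_AE[OF i] by simp
    then show False by (simp add: AE_False)
  qed
qed

definition stable_const :: "'a::euclidean_space itself \<Rightarrow> real \<Rightarrow> real" where
  "stable_const _ \<gamma> = (\<integral>z. exp (- norm (z :: 'a)) powr \<gamma> \<partial>lborel)"

lemma stable_const_nonneg [simp]: "0 \<le> stable_const TYPE('a::euclidean_space) \<gamma>"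
  unfolding stable_const_def by simp

text \<open>Here the stable index enters. For \<open>\<gamma> < 1\<close> the potential has infinite mean, but the expectation of its
  saturated version is one minus a Laplace transform, hence at most a multiple of \<open>c\<^sup>\<gamma>\<close>.\<close>

lemma annealed_saturation_le:
  fixes P :: "'a::euclidean_space measure measure"
  assumes P: "stable_random_measure_law \<gamma> P" and c: "0 \<le> c"
  shows "(\<integral>\<^sup>+ G. ennreal (1 - exp (- (c * exp_potential G y))) \<partial>P) \<le> ennreal (c powr \<gamma> * stable_const TYPE('a) \<gamma>)"
proof -
  interpret prob_space P using P by (simp add: stable_random_measure_law_def)
  have sP: "sets P = sets M_tem_algebra" using P by (simp add: stable_random_measure_law_def)
  note [measurable_cong] = sP
  define \<phi> where "\<phi> = (\<lambda>z. c * exp (- norm (y - z)))"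
  have \<phi>: "\<phi> \<in> C_exp_nonneg" unfolding \<phi>_def by (rule exp_norm_diff_in_C_exp[OF c])
  have pr: "pairing G \<phi> = c * exp_potential G y" for G
    by (simp add: \<phi>_def exp_potential_def pairing_def)
  have m: "(\<lambda>G. pairing G \<phi>) \<in> borel_measurable P"
    using borel_measurable_pairing[of \<phi>] \<phi> by (simp add: C_exp_nonneg_def cong: measurable_cong_sets)
  have e: "integrable P (\<lambda>G. exp (- pairing G \<phi>))" "0 < (\<integral>G. exp (- pairing G \<phi>) \<partial>P)"
    by (rule expectation_exp_neg[OF m]; simp add: pr c)+
  \<comment> \<open>Homogeneity of degree \<open>\<gamma>\<close> and translation invariance of Lebesgue measure.\<close>
  have "(\<integral>z. \<phi> z powr \<gamma> \<partial>lborel) = c powr \<gamma> * (\<integral>z. exp (- norm (y - z)) powr \<gamma> \<partial>lborel)"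
    unfolding \<phi>_def using c by (simp add: powr_mult)
  also have "(\<integral>z. exp (- norm (y - z)) powr \<gamma> \<partial>lborel) = (\<integral>z. exp (- norm (z - y)) powr \<gamma> \<partial>lborel)"
    by (simp add: norm_minus_commute)
  also have "\<dots> = stable_const TYPE('a) \<gamma>"
  proof -
    have "(\<integral>z. exp (- norm (z - y)) powr \<gamma> \<partial>lborel) = (\<integral>z. exp (- norm (z - y)) powr \<gamma> \<partial>(distr lborel borel ((+) y)))"
      by (simp add: lborel_distr_plus)
    also have "\<dots> = stable_const TYPE('a) \<gamma>"
      unfolding stable_const_def by (subst integral_distr) auto
    finally show ?thesis .
  qed
  finally have "- ln (\<integral>G. exp (- pairing G \<phi>) \<partial>P) = c powr \<gamma> * stable_const TYPE('a) \<gamma>"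
    using P \<phi> by (simp add: stable_random_measure_law_def)
  then have "(\<integral>G. exp (- pairing G \<phi>) \<partial>P) = exp (- (c powr \<gamma> * stable_const TYPE('a) \<gamma>))"
    using e(2) by (metis exp_ln minus_minus)
  then have "1 - (\<integral>G. exp (- pairing G \<phi>) \<partial>P) \<le> c powr \<gamma> * stable_const TYPE('a) \<gamma>"
    using exp_ge_add_one_self[of "- (c powr \<gamma> * stable_const TYPE('a) \<gamma>)"] by simp
  moreover have "(\<integral>\<^sup>+ G. ennreal (1 - exp (- pairing G \<phi>)) \<partial>P) = ennreal (\<integral>G. 1 - exp (- pairing G \<phi>) \<partial>P)"
    by (rule nn_integral_eq_integral) (use e c in \<open>auto simp: pr\<close>)
  moreover have "(\<integral>G. 1 - exp (- pairing G \<phi>) \<partial>P) = 1 - (\<integral>G. exp (- pairing G \<phi>) \<partial>P)"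
    using e by (simp add: prob_space)
  ultimately show ?thesis by (simp add: pr ennreal_leI)
qed

lemma borel_measurable_loss_bound:
  fixes P :: "'a::euclidean_space measure measure"
  assumes sP: "sets P = sets M_tem_algebra" and \<mu>: "\<mu> \<in> M_tem"
  shows "(\<lambda>G. \<integral>\<^sup>+ x. (\<Sum>n<N. heat (r n) (\<lambda>y. ennreal (2 * (B * exp_weight l y) *
      (1 - exp (- (c * (B * exp_weight l y) * exp_potential G y))))) x) \<partial>\<mu>) \<in> borel_measurable P"
proof -
  interpret M: sigma_finite_measure \<mu> by (rule sigma_finite_M_tem[OF \<mu>])
  note [measurable_cong] = sets_M_tem[OF \<mu>]
  note [measurable] = borel_measurable_exp_potential_joint[OF sP]
  show ?thesis by measurable
qed

text \<open>The expectation over the medium passes inside the heat semigroup, where the previous estimate gives a multiple of the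
  weight of order \<open>B\<^sup>1\<^sup>+\<^sup>\<gamma>\<close>; the weight is then carried back through the semigroup to \<open>\<mu>\<close>.\<close>

lemma annealed_loss_le:
  fixes P :: "'a::euclidean_space measure measure" and N :: nat
  assumes P: "stable_random_measure_law \<gamma> P" and \<mu>: "\<mu> \<in> M_tem"
    and c: "0 \<le> c" and B: "0 \<le> B" and l: "0 \<le> l" and \<gamma>: "0 < \<gamma>"
    and r: "\<And>n. n < N \<Longrightarrow> 0 \<le> r n" "\<And>n. n < N \<Longrightarrow> r n \<le> T"
  shows "(\<integral>\<^sup>+ G. (\<integral>\<^sup>+ x. (\<Sum>n<N. heat (r n) (\<lambda>y. ennreal (2 * (B * exp_weight l y) *
      (1 - exp (- (c * (B * exp_weight l y) * exp_potential G y))))) x) \<partial>\<mu>) \<partial>P)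
    \<le> ennreal (2 * real N * (c * B) powr \<gamma> * stable_const TYPE('a) \<gamma> * B * heat_bound TYPE('a) (l\<^sup>2 * T))
       * (\<integral>\<^sup>+ x. ennreal (exp_weight l x) \<partial>\<mu>)"
proof -
  interpret P: prob_space P using P by (simp add: stable_random_measure_law_def)
  interpret M: sigma_finite_measure \<mu> by (rule sigma_finite_M_tem[OF \<mu>])
  interpret PM: pair_sigma_finite \<mu> P ..
  have sP: "sets P = sets M_tem_algebra" using P by (simp add: stable_random_measure_law_def)
  note [measurable_cong] = sP sets_M_tem[OF \<mu>]
  note [measurable] = borel_measurable_exp_potential_joint[OF sP]
  let ?f = "\<lambda>G y. ennreal (2 * (B * exp_weight l y) * (1 - exp (- (c * (B * exp_weight l y) * exp_potential G y))))"
  let ?K = "2 * (c * B) powr \<gamma> * stable_const TYPE('a) \<gamma> * B"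
  have K: "0 \<le> ?K" using B by simp
  have assoc: "ennreal a * ennreal (b * d) = ennreal (a * b) * ennreal d"
    if "0 \<le> a" "0 \<le> b" "0 \<le> d" for a b d
    using that by (simp add: ennreal_mult mult.assoc)
  have inner: "(\<integral>\<^sup>+ G. ?f G y \<partial>P) \<le> ennreal ?K * ennreal (exp_weight l y)" for y
  proof -
    let ?E = "B * exp_weight l y"
    have E: "0 \<le> ?E" using B by simp
    have "(\<integral>\<^sup>+ G. ?f G y \<partial>P) = ennreal (2 * ?E) * (\<integral>\<^sup>+ G. ennreal (1 - exp (- (c * ?E * exp_potential G y))) \<partial>P)"
      using E c by (subst nn_integral_cmult[symmetric]) (auto simp: ennreal_mult)
    also have "\<dots> \<le> ennreal (2 * ?E) * ennreal ((c * ?E) powr \<gamma> * stable_const TYPE('a) \<gamma>)"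
      using E c by (intro mult_left_mono annealed_saturation_le[OF P]) auto
    also have "\<dots> \<le> ennreal (2 * ?E) * ennreal ((c * B) powr \<gamma> * stable_const TYPE('a) \<gamma>)"
    proof -
      have "exp_weight l y \<le> 1" using l by (simp add: exp_weight_def)
      then have "?E \<le> B" using B by (intro mult_left_le) auto
      then show ?thesis using B c \<gamma>
        by (intro mult_left_mono ennreal_leI mult_right_mono powr_mono2 mult_left_mono) auto
    qed
    finally show ?thesis using B by (simp add: ennreal_mult[symmetric] mult_ac)
  qed
  have "(\<integral>\<^sup>+ G. (\<integral>\<^sup>+ x. (\<Sum>n<N. heat (r n) (?f G) x) \<partial>\<mu>) \<partial>P) = (\<integral>\<^sup>+ x. (\<integral>\<^sup>+ G. (\<Sum>n<N. heat (r n) (?f G) x) \<partial>P) \<partial>\<mu>)"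
    by (rule PM.Fubini') measurable
  also have "\<dots> = (\<integral>\<^sup>+ x. (\<Sum>n<N. heat (r n) (\<lambda>y. \<integral>\<^sup>+ G. ?f G y \<partial>P) x) \<partial>\<mu>)"
  proof (intro nn_integral_cong)
    fix x
    have "(\<integral>\<^sup>+ G. (\<Sum>n<N. heat (r n) (?f G) x) \<partial>P) = (\<Sum>n<N. \<integral>\<^sup>+ G. heat (r n) (?f G) x \<partial>P)"
      by (rule nn_integral_sum) measurable
    also have "\<dots> = (\<Sum>n<N. heat (r n) (\<lambda>y. \<integral>\<^sup>+ G. ?f G y \<partial>P) x)"
      by (intro sum.cong refl heat_nn_integral[symmetric] P.sigma_finite_measure_axioms) measurable
    finally show "(\<integral>\<^sup>+ G. (\<Sum>n<N. heat (r n) (?f G) x) \<partial>P) = (\<Sum>n<N. heat (r n) (\<lambda>y. \<integral>\<^sup>+ G. ?f G y \<partial>P) x)" .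
  qed
  also have "\<dots> \<le> (\<integral>\<^sup>+ x. ennreal (real N * (?K * heat_bound TYPE('a) (l\<^sup>2 * T))) * ennreal (exp_weight l x) \<partial>\<mu>)"
  proof (intro nn_integral_mono)
    fix x
    have "heat (r n) (\<lambda>y. \<integral>\<^sup>+ G. ?f G y \<partial>P) x \<le> ennreal (?K * heat_bound TYPE('a) (l\<^sup>2 * T)) * ennreal (exp_weight l x)"
      if n: "n < N" for n
    proof -
      have "heat (r n) (\<lambda>y. \<integral>\<^sup>+ G. ?f G y \<partial>P) x \<le> heat (r n) (\<lambda>y. ennreal ?K * ennreal (exp_weight l y)) x"
        by (intro heat_mono inner)
      also have "\<dots> = ennreal ?K * heat (r n) (\<lambda>y. ennreal (exp_weight l y)) x"
        by (rule heat_cmult) measurable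
      also have "\<dots> \<le> ennreal ?K * ennreal (heat_bound TYPE('a) (l\<^sup>2 * r n) * exp_weight l x)"
        using r n l by (intro mult_left_mono heat_exp_weight_le) auto
      also have "\<dots> \<le> ennreal ?K * ennreal (heat_bound TYPE('a) (l\<^sup>2 * T) * exp_weight l x)"
        using r n by (intro mult_left_mono ennreal_leI mult_right_mono) (auto simp: heat_bound_def mult_left_mono)
      also have "\<dots> = ennreal (?K * heat_bound TYPE('a) (l\<^sup>2 * T)) * ennreal (exp_weight l x)"
        by (rule assoc[OF K heat_bound_nonneg exp_weight_nonneg])
      finally show ?thesis .
    qed
    then have "(\<Sum>n<N. heat (r n) (\<lambda>y. \<integral>\<^sup>+ G. ?f G y \<partial>P) x)
        \<le> (\<Sum>n<N. ennreal (?K * heat_bound TYPE('a) (l\<^sup>2 * T)) * ennreal (exp_weight l x))"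
      by (intro sum_mono) auto
    also have "\<dots> = ennreal (real N * (?K * heat_bound TYPE('a) (l\<^sup>2 * T))) * ennreal (exp_weight l x)"
      using K ennreal_mult[of "real N" "?K * heat_bound TYPE('a) (l\<^sup>2 * T)"]
      by (simp add: ennreal_of_nat_eq_real_of_nat mult.assoc[symmetric])
    finally show "(\<Sum>n<N. heat (r n) (\<lambda>y. \<integral>\<^sup>+ G. ?f G y \<partial>P) x)
        \<le> ennreal (real N * (?K * heat_bound TYPE('a) (l\<^sup>2 * T))) * ennreal (exp_weight l x)" .
  qed
  also have "\<dots> = ennreal (real N * (?K * heat_bound TYPE('a) (l\<^sup>2 * T))) * (\<integral>\<^sup>+ x. ennreal (exp_weight l x) \<partial>\<mu>)"
    by (rule nn_integral_cmult) measurable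
  finally show ?thesis by (simp add: mult_ac)
qed

section \<open>Deviations of the reactant from its mean\<close>

lemma space_path_space: "space path_space = paths"
  by (simp add: path_algebra_def space_measure_of_conv)

lemma measurable_path_coordinate:
  assumes "0 \<le> T"
  shows "(\<lambda>w. w T) \<in> path_space \<rightarrow>\<^sub>M M_tem_algebra"
proof (rule measurableI)
  fix w assume "w \<in> space path_space"
  then show "w T \<in> space M_tem_algebra"
    using assms by (auto simp: space_path_space space_M_tem_algebra paths_def PiE_def Pi_def)
next
  fix A assume "A \<in> sets M_tem_algebra"
  then have "{w \<in> paths. w T \<in> A} \<in> sets path_space"
    using assms unfolding path_algebra_def by (subst sets_measure_of) (auto intro!: sigma_sets.Basic)
  moreover have "(\<lambda>w. w T) -` A \<inter> space path_space = {w \<in> paths. w T \<in> A}"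
    by (auto simp: space_path_space)
  ultimately show "(\<lambda>w. w T) -` A \<inter> space path_space \<in> sets path_space" by simp
qed

lemma M_tem_pathsD: "w \<in> paths \<Longrightarrow> 0 \<le> T \<Longrightarrow> w T \<in> M_tem"
  by (auto simp: paths_def PiE_def Pi_def)

lemma borel_measurable_path_pairing:
  "0 \<le> T \<Longrightarrow> f \<in> C_exp \<Longrightarrow> (\<lambda>w. pairing (w T) f) \<in> borel_measurable path_space"
  using measurable_compose[OF measurable_path_coordinate borel_measurable_pairing] .

text \<open>Turns the Laplace transforms at 1 and 2 into a Chebyshev bound: \<open>exp (- z)\<close> is far from 1 whenever \<open>z\<close> is
  far from 0, on either side.\<close>

lemma exp_deviation_ge:
  fixes z \<epsilon> :: real
  assumes "0 < \<epsilon>" "\<epsilon> \<le> \<bar>z\<bar>"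
  shows "(1 - exp (- \<epsilon>))\<^sup>2 \<le> (exp (- z) - 1)\<^sup>2"
proof (cases "0 \<le> z")
  case True
  then have "1 - exp (- \<epsilon>) \<le> 1 - exp (- z)" using assms by simp
  then have "(1 - exp (- \<epsilon>))\<^sup>2 \<le> (1 - exp (- z))\<^sup>2" using assms by (intro power_mono) auto
  then show ?thesis by (simp add: power2_commute)
next
  case False
  have "1 - exp (- \<epsilon>) \<le> \<epsilon>" using exp_ge_add_one_self[of "- \<epsilon>"] by simp
  also have "\<epsilon> \<le> - z" using False assms by simp
  also have "- z \<le> exp (- z) - 1" using exp_ge_add_one_self[of "- z"] by simp
  finally show ?thesis using assms by (intro power_mono) auto
qed

text \<open>If \<open>Z\<close> is the deviation of \<open>\<langle>X\<^sub>T, \<psi>\<rangle>\<close> from its mean, then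
  \<open>E (exp (- Z) - 1)\<^sup>2 \<le> exp D - 1\<close>, where \<open>D\<close> is the loss of the mild solution with datum \<open>2 \<psi>\<close>,
  integrated against the initial measure. Everything is read off from the Laplace functional of \<open>X\<close>.\<close>

lemma quenched_deviation_le:
  fixes G \<mu> :: "'a::euclidean_space measure" and N :: nat
  assumes X: "super_brownian_motion \<rho> (smoothed_catalyst G) Q" and G: "G \<in> M_tem" and \<mu>: "\<mu> \<in> M_tem"
    and \<psi>: "\<psi> \<in> C_exp_nonneg" and \<psi>_le: "\<And>x. \<psi> x \<le> A * exp_weight l x"
    and \<rho>: "0 \<le> \<rho>" and A: "0 \<le> A" and l: "0 < l" "l \<le> 1 / 2" and T: "0 \<le> T" and N: "0 < N" "T \<le> real N"
    and \<epsilon>: "0 < \<epsilon>"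
  shows "emeasure (Q \<mu>) {w \<in> paths. \<epsilon> \<le> \<bar>pairing (w T) \<psi> - pairing \<mu> (bm_fun T \<psi>)\<bar>}
    \<le> ennreal (2 / (1 - exp (- \<epsilon>))\<^sup>2) * (\<integral>\<^sup>+ x. (\<Sum>n<N. heat (T - real (Suc n) * (T / N))
      (\<lambda>y. ennreal (2 * (2 * A * heat_bound TYPE('a) (l\<^sup>2 * T) * exp_weight l y) *
      (1 - exp (- (exp 1 * heat_bound TYPE('a) 4 * \<rho> * (2 * A * heat_bound TYPE('a) (l\<^sup>2 * T) * exp_weight l y)
        * exp_potential G y))))) x) \<partial>\<mu>)"
    (is "emeasure _ ?S \<le> _ * ?R")
proof -
  have "Q \<mu> \<in> space (prob_algebra path_space)"
    using X \<mu> by (auto simp: super_brownian_motion_def markov_family_def space_M_tem_algebra dest: measurable_space)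
  then have "prob_space (Q \<mu>)" and sQ: "sets (Q \<mu>) = sets path_space"
    by (simp_all add: space_prob_algebra)
  then interpret prob_space "Q \<mu>" by simp
  note [measurable_cong] = sQ sets_M_tem[OF \<mu>]
  have spQ: "space (Q \<mu>) = paths" using sets_eq_imp_space_eq[OF sQ] by (simp add: space_path_space)
  define Y where "Y = (\<lambda>w. pairing (w T) \<psi>)"
  define m where "m = pairing \<mu> (bm_fun T \<psi>)"
  have \<psi>C: "\<psi> \<in> C_exp" and \<psi>0: "\<And>x. 0 \<le> \<psi> x" using \<psi> by (auto simp: C_exp_nonneg_def)
  have \<psi>2: "(\<lambda>x. 2 * \<psi> x) \<in> C_exp_nonneg" using C_exp_mult[OF \<psi>C] \<psi>0 by (simp add: C_exp_nonneg_def)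
  note \<psi>m [measurable] = C_exp_borel[OF \<psi>C]
  have [measurable]: "Y \<in> borel_measurable (Q \<mu>)"
    using borel_measurable_path_pairing[OF T \<psi>C] by (simp add: Y_def cong: measurable_cong_sets)
  have Y0: "0 \<le> Y w" for w by (simp add: Y_def pairing_def \<psi>0)
  have S: "?S = {w \<in> space (Q \<mu>). \<epsilon> \<le> \<bar>Y w - m\<bar>}" by (simp add: spQ Y_def m_def)
  have S_sets: "?S \<in> sets (Q \<mu>)" unfolding S by measurable
  have laplace: "\<exists>u. mild_solution \<rho> (smoothed_catalyst G) \<phi> u \<and>
      - ln (\<integral>w. exp (- pairing (w T) \<phi>) \<partial>Q \<mu>) = pairing \<mu> (u T)" if "\<phi> \<in> C_exp_nonneg" for \<phi>
    using X that \<mu> T unfolding super_brownian_motion_def the_mild_solution_def by blast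
  obtain u1 where u1: "mild_solution \<rho> (smoothed_catalyst G) \<psi> u1"
      "- ln (\<integral>w. exp (- pairing (w T) \<psi>) \<partial>Q \<mu>) = pairing \<mu> (u1 T)"
    using laplace[OF \<psi>] by blast
  obtain u2 where u2: "mild_solution \<rho> (smoothed_catalyst G) (\<lambda>x. 2 * \<psi> x) u2"
      "- ln (\<integral>w. exp (- pairing (w T) (\<lambda>x. 2 * \<psi> x)) \<partial>Q \<mu>) = pairing \<mu> (u2 T)"
    using laplace[OF \<psi>2] by blast
  have exp_eq: "a = exp (- p)" if "- ln a = p" "0 < a" for a p :: real
    using that by auto
  let ?B = "\<lambda>x. A * heat_bound TYPE('a) (l\<^sup>2 * T) * exp_weight l x"
  have bm: "0 \<le> bm_fun T \<psi> x" "bm_fun T \<psi> x \<le> ?B x" for x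
    using bm_fun_exp_weight_le(2,3)[OF A less_imp_le[OF l(1)] \<psi>m \<psi>0 \<psi>_le T order_refl] by auto
  have "(\<lambda>x. heat T (\<lambda>y. ennreal (\<psi> y)) x) \<in> borel_measurable borel" by measurable
  then have "(\<lambda>x. enn2real (heat T (\<lambda>y. ennreal (\<psi> y)) x)) \<in> borel_measurable borel" by measurable
  then have bm_meas [measurable]: "bm_fun T \<psi> \<in> borel_measurable borel"
    unfolding bm_fun_exp_weight_le(1)[OF A less_imp_le[OF l(1)] \<psi>m \<psi>0 \<psi>_le T order_refl, symmetric]
    using bm by simp
  have bm_int: "integrable \<mu> (bm_fun T \<psi>)"
    by (rule integrable_M_tem[OF \<mu> bm_meas l(1)]) (use bm in \<open>simp add: abs_of_nonneg\<close>)
  have u_int: "integrable \<mu> (u T)" "\<And>x. u T x \<le> c * bm_fun T \<psi> x"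
    if u: "mild_solution \<rho> (smoothed_catalyst G) (\<lambda>x. c * \<psi> x) u" and c: "0 < c" for u c
  proof -
    have c\<psi>: "(\<lambda>x. c * \<psi> x) \<in> borel_measurable borel" "\<And>x. 0 \<le> c * \<psi> x" "\<And>x. c * \<psi> x \<le> c * A * exp_weight l x"
      using c \<psi>0 \<psi>_le by (auto simp: mult.assoc)
    have cA: "0 \<le> c * A" using c A by simp
    show le: "u T x \<le> c * bm_fun T \<psi> x" for x
      using u_le_bm_fun[OF G u \<rho> cA l T c\<psi> T, of x] by (simp add: bm_fun_cmult)
    have "(\<lambda>x. (T, x)) \<in> borel \<rightarrow>\<^sub>M restrict_space borel {0..} \<Otimes>\<^sub>M (borel :: 'a measure)"
      using T by (intro measurable_Pair measurable_restrict_space2) auto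
    then have [measurable]: "u T \<in> borel_measurable borel"
      using measurable_compose[of "\<lambda>x. (T, x)" borel _ "\<lambda>(t, x). u t x" borel] u
      unfolding mild_solution_def by simp
    have um: "u T \<in> borel_measurable \<mu>" by measurable
    have "0 \<le> u T x" for x using u T unfolding mild_solution_def by blast
    then show "integrable \<mu> (u T)"
      using le by (intro Bochner_Integration.integrable_bound[OF integrable_mult_right[OF bm_int, of c]])
        (auto simp: um intro!: AE_I2 order_trans[OF le abs_ge_self])
  qed
  have e1: "integrable (Q \<mu>) (\<lambda>w. exp (- Y w))" "0 < (\<integral>w. exp (- Y w) \<partial>Q \<mu>)"
    by (rule expectation_exp_neg; simp add: Y0)+
  have e2: "integrable (Q \<mu>) (\<lambda>w. exp (- (2 * Y w)))" "0 < (\<integral>w. exp (- (2 * Y w)) \<partial>Q \<mu>)"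
    by (rule expectation_exp_neg; simp add: Y0)+
  define D where "D = pairing \<mu> (\<lambda>x. 2 * bm_fun T \<psi> x - u2 T x)"
  \<comment> \<open>The first moment of \<open>exp (- Y)\<close> is only needed from below, where \<open>u1 \<le> S\<^sub>T \<psi>\<close> suffices; the second
    moment is exact and produces the loss \<open>D\<close> of the mild solution with datum \<open>2 \<psi>\<close>.\<close>
  have "pairing \<mu> (u1 T) \<le> m"
    unfolding m_def pairing_def
    by (rule integral_mono) (use u_int[of 1 u1] u1(1) bm_int in auto)
  moreover have "(\<integral>w. exp (- Y w) \<partial>Q \<mu>) = exp (- pairing \<mu> (u1 T))"
    using exp_eq[OF u1(2)] e1(2) unfolding Y_def by simp
  ultimately have L1: "exp (- m) \<le> (\<integral>w. exp (- Y w) \<partial>Q \<mu>)" by simp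
  have D: "D = 2 * m - pairing \<mu> (u2 T)"
    unfolding D_def m_def pairing_def using u_int(1)[OF u2(1)] bm_int by simp
  have "(\<integral>w. exp (- (2 * Y w)) \<partial>Q \<mu>) = exp (- pairing \<mu> (u2 T))"
    using exp_eq[OF u2(2)] e2(2) unfolding Y_def pairing_cmult by simp
  then have L2: "(\<integral>w. exp (- (2 * Y w)) \<partial>Q \<mu>) = exp (D - 2 * m)" by (simp add: D)
  have sq: "(exp (- (Y w - m)) - 1)\<^sup>2 = exp (2 * m) * exp (- (2 * Y w)) - 2 * exp m * exp (- Y w) + 1" for w
  proof -
    have a: "exp (- (Y w - m)) = exp m * exp (- Y w)" by (simp add: exp_add[symmetric])
    have b: "exp (2 * m) = exp m * exp m" "exp (- (2 * Y w)) = exp (- Y w) * exp (- Y w)"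
      by (simp_all add: exp_add[symmetric])
    show ?thesis unfolding a b by (simp add: power2_eq_square algebra_simps)
  qed
  have sq_int: "integrable (Q \<mu>) (\<lambda>w. (exp (- (Y w - m)) - 1)\<^sup>2)"
    unfolding sq using e1 e2 by simp
  have "(\<integral>w. (exp (- (Y w - m)) - 1)\<^sup>2 \<partial>Q \<mu>) = exp (2 * m) * exp (D - 2 * m) - 2 * exp m * (\<integral>w. exp (- Y w) \<partial>Q \<mu>) + 1"
    unfolding sq using e1 e2 L2 by (simp add: prob_space)
  also have "\<dots> \<le> exp D - 2 * exp m * exp (- m) + 1"
    using mult_left_mono[OF L1, of "2 * exp m"] by (simp add: exp_add[symmetric])
  also have "\<dots> = exp D - 1" by (simp add: exp_minus)
  finally have E: "(\<integral>w. (exp (- (Y w - m)) - 1)\<^sup>2 \<partial>Q \<mu>) \<le> exp D - 1" .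
  have D0: "0 \<le> D"
    unfolding D_def pairing_def using u_int(2)[OF u2(1)] by (intro Bochner_Integration.integral_nonneg) simp
  let ?c = "(1 - exp (- \<epsilon>))\<^sup>2"
  have c: "0 < ?c" "?c \<le> 1" using \<epsilon> by (auto simp: power_le_one)
  have "ennreal ?c * emeasure (Q \<mu>) ?S = (\<integral>\<^sup>+ w. ennreal ?c * indicator ?S w \<partial>Q \<mu>)"
    using S_sets by (simp add: nn_integral_cmult)
  also have "\<dots> \<le> (\<integral>\<^sup>+ w. ennreal ((exp (- (Y w - m)) - 1)\<^sup>2) \<partial>Q \<mu>)"
    unfolding S using exp_deviation_ge[OF \<epsilon>]
    by (intro nn_integral_mono) (auto simp: indicator_def simp del: minus_diff_eq intro!: ennreal_leI)
  also have "\<dots> = ennreal (\<integral>w. (exp (- (Y w - m)) - 1)\<^sup>2 \<partial>Q \<mu>)"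
    by (rule nn_integral_eq_integral[OF sq_int]) simp
  also have "\<dots> \<le> ennreal (exp D - 1)" by (rule ennreal_leI[OF E])
  finally have cheb: "?c * prob ?S \<le> exp D - 1"
    using c D0 by (simp add: emeasure_eq_measure ennreal_mult[symmetric])
  \<comment> \<open>A bound linear in \<open>D\<close> is wanted, since only the expectation of \<open>D\<close> over the medium is controlled.
    For \<open>D > 1\<close> it holds because probabilities are at most 1.\<close>
  have "prob ?S \<le> 2 / ?c * D"
  proof (cases "D \<le> 1")
    case True
    have "exp D - 1 \<le> 2 * D"
      using exp_bound[OF D0 True] mult_left_le[OF True D0] by (simp add: power2_eq_square)
    with cheb have "?c * prob ?S \<le> 2 * D" by auto
    then show ?thesis using c(1) by (simp add: pos_le_divide_eq mult.commute)
  next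
    case False
    have "prob ?S \<le> 1" by simp
    also have "1 \<le> 2 / ?c" using c by (simp add: le_divide_eq)
    also have "\<dots> \<le> 2 / ?c * D" using False c(1) mult_left_mono[of 1 D "2 / ?c"] by simp
    finally show ?thesis .
  qed
  then have "emeasure (Q \<mu>) ?S \<le> ennreal (2 / ?c) * ennreal D"
    using c(1) D0 by (simp add: emeasure_eq_measure ennreal_mult[symmetric] ennreal_leI)
  also have "ennreal D = (\<integral>\<^sup>+ x. ennreal (2 * bm_fun T \<psi> x - u2 T x) \<partial>\<mu>)"
    unfolding D_def pairing_def using u_int[OF u2(1)] bm_int by (intro nn_integral_eq_integral[symmetric]) auto
  also have "\<dots> \<le> ?R"
  proof (rule nn_integral_mono)
    fix x
    have 2: "(\<lambda>x. 2 * \<psi> x) \<in> borel_measurable borel" "\<And>x. 0 \<le> 2 * \<psi> x" "\<And>x. 2 * \<psi> x \<le> 2 * A * exp_weight l x"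
      using \<psi>0 \<psi>_le by (auto simp: mult.assoc)
    show "ennreal (2 * bm_fun T \<psi> x - u2 T x) \<le> (\<Sum>n<N. heat (T - real (Suc n) * (T / N))
      (\<lambda>y. ennreal (2 * (2 * A * heat_bound TYPE('a) (l\<^sup>2 * T) * exp_weight l y) *
      (1 - exp (- (exp 1 * heat_bound TYPE('a) 4 * \<rho> * (2 * A * heat_bound TYPE('a) (l\<^sup>2 * T) * exp_weight l y)
        * exp_potential G y))))) x)"
      using loss_le[OF G u2(1) \<rho> _ l T 2 N, of x] A by (simp only: bm_fun_cmult mult_nonneg_nonneg zero_le_numeral)
  qed
  finally show ?thesis by (simp add: mult_left_mono)
qed

lemma annealed_deviation_le:
  fixes P :: "'a::euclidean_space measure measure" and N :: nat
  assumes P: "stable_random_measure_law \<gamma> P" and Q: "catalytic_sbm \<rho> P Q" and \<nu>: "\<nu> \<in> M_tem" and \<gamma>: "0 < \<gamma>"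
    and \<psi>: "\<psi> \<in> C_exp_nonneg" and \<psi>_le: "\<And>x. \<psi> x \<le> A * exp_weight l x"
    and \<rho>: "0 \<le> \<rho>" and A: "0 \<le> A" and l: "0 < l" "l \<le> 1 / 2" and T: "0 \<le> T" and N: "0 < N" "T \<le> real N"
    and \<epsilon>: "0 < \<epsilon>"
  shows "emeasure (annealed_law P Q \<nu>) {w \<in> paths. \<epsilon> \<le> \<bar>pairing (w T) \<psi> - pairing \<nu> (bm_fun T \<psi>)\<bar>}
    \<le> ennreal (2 / (1 - exp (- \<epsilon>))\<^sup>2) * (ennreal (2 * real N *
        (exp 1 * heat_bound TYPE('a) 4 * \<rho> * (2 * A * heat_bound TYPE('a) (l\<^sup>2 * T))) powr \<gamma> * stable_const TYPE('a) \<gamma>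
        * (2 * A * heat_bound TYPE('a) (l\<^sup>2 * T)) * heat_bound TYPE('a) (l\<^sup>2 * T))
       * (\<integral>\<^sup>+ x. ennreal (exp_weight l x) \<partial>\<nu>))"
    (is "emeasure _ ?S \<le> _")
proof -
  have pP: "prob_space P" and sP: "sets P = sets M_tem_algebra"
    using P by (auto simp: stable_random_measure_law_def)
  have spP: "space P = M_tem" using sets_eq_imp_space_eq[OF sP] by (simp add: space_M_tem_algebra)
  have QP: "(\<lambda>G. Q G \<nu>) \<in> P \<rightarrow>\<^sub>M prob_algebra path_space"
    and X: "AE G in P. super_brownian_motion \<rho> (smoothed_catalyst G) (Q G)"
    using Q \<nu> by (auto simp: catalytic_sbm_def)
  have \<psi>C: "\<psi> \<in> C_exp" using \<psi> by (simp add: C_exp_nonneg_def)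
  note [measurable] = borel_measurable_path_pairing[OF T \<psi>C]
  have "?S = {w \<in> space path_space. \<epsilon> \<le> \<bar>pairing (w T) \<psi> - pairing \<nu> (bm_fun T \<psi>)\<bar>}"
    by (simp add: space_path_space)
  also have "\<dots> \<in> sets path_space" by measurable
  finally have S: "?S \<in> sets path_space" .
  let ?c = "exp 1 * heat_bound TYPE('a) 4 * \<rho>" and ?B = "2 * A * heat_bound TYPE('a) (l\<^sup>2 * T)"
  let ?r = "\<lambda>n. T - real (Suc n) * (T / N)"
  let ?R = "\<lambda>G. \<integral>\<^sup>+ x. (\<Sum>n<N. heat (?r n) (\<lambda>y. ennreal (2 * (?B * exp_weight l y) *
      (1 - exp (- (?c * (?B * exp_weight l y) * exp_potential G y))))) x) \<partial>\<nu>"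
  have r: "0 \<le> ?r n" "?r n \<le> T" if "n < N" for n
  proof -
    have "real (Suc n) * (T / N) \<le> real N * (T / N)"
      using that T by (intro mult_right_mono) auto
    then show "0 \<le> ?r n" using N by simp
    show "?r n \<le> T" using T by simp
  qed
  have "emeasure (annealed_law P Q \<nu>) ?S = (\<integral>\<^sup>+ G. emeasure (Q G \<nu>) ?S \<partial>P)"
    unfolding annealed_law_def
    using pP by (intro emeasure_bind_prob_algebra[OF _ QP S]) (simp add: space_prob_algebra)
  also have "\<dots> \<le> (\<integral>\<^sup>+ G. ennreal (2 / (1 - exp (- \<epsilon>))\<^sup>2) * ?R G \<partial>P)"
  proof (rule nn_integral_mono_AE)
    show "AE G in P. emeasure (Q G \<nu>) ?S \<le> ennreal (2 / (1 - exp (- \<epsilon>))\<^sup>2) * ?R G"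
      using X AE_space
    proof eventually_elim
      case (elim G)
      then show ?case
        by (intro quenched_deviation_le \<nu> \<psi> \<psi>_le \<rho> A l T N \<epsilon>) (auto simp: spP)
    qed
  qed
  also have "\<dots> = ennreal (2 / (1 - exp (- \<epsilon>))\<^sup>2) * (\<integral>\<^sup>+ G. ?R G \<partial>P)"
    by (rule nn_integral_cmult[OF borel_measurable_loss_bound[OF sP \<nu>]])
  also have "\<dots> \<le> ennreal (2 / (1 - exp (- \<epsilon>))\<^sup>2) * (ennreal (2 * real N * (?c * ?B) powr \<gamma> * stable_const TYPE('a) \<gamma>
        * ?B * heat_bound TYPE('a) (l\<^sup>2 * T)) * (\<integral>\<^sup>+ x. ennreal (exp_weight l x) \<partial>\<nu>))"
    using l A \<rho> r by (intro mult_left_mono annealed_loss_le[OF P \<nu>]) (auto simp: \<gamma>)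
  finally show ?thesis .
qed

section \<open>Scaling\<close>

lemma bm_density_scale:
  fixes v :: "'a::euclidean_space"
  assumes k: "0 < k" and t: "0 < t"
  shows "k ^ DIM('a) * bm_density (k\<^sup>2 * t) (k *\<^sub>R v) = bm_density t v"
proof -
  have "(2 * pi * (k\<^sup>2 * t)) powr (- real DIM('a) / 2) = (k\<^sup>2 * (2 * pi * t)) powr (- real DIM('a) / 2)"
    by (rule arg_cong2[where f="(powr)"]) (simp_all add: mult_ac)
  also have "\<dots> = (k\<^sup>2) powr (- real DIM('a) / 2) * (2 * pi * t) powr (- real DIM('a) / 2)"
    by (intro powr_mult)
  also have "(k\<^sup>2) powr (- real DIM('a) / 2) = (k powr 2) powr (- real DIM('a) / 2)"
    using k by (simp add: powr_numeral)
  also have "\<dots> = inverse (k ^ DIM('a))"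
    unfolding powr_powr using k by (simp add: powr_minus powr_realpow)
  finally have "k ^ DIM('a) * (2 * pi * (k\<^sup>2 * t)) powr (- real DIM('a) / 2) = (2 * pi * t) powr (- real DIM('a) / 2)"
    using k by simp
  moreover have "(norm (k *\<^sub>R v))\<^sup>2 / (2 * (k\<^sup>2 * t)) = (norm v)\<^sup>2 / (2 * t)"
    using k by (simp add: power_mult_distrib)
  ultimately show ?thesis
    unfolding bm_density_def by (simp add: mult.assoc[symmetric])
qed

lemma heat_scale:
  fixes f :: "'a::euclidean_space \<Rightarrow> ennreal"
  assumes k: "0 < k" and t: "0 \<le> t" and [measurable]: "f \<in> borel_measurable borel"
  shows "heat (k\<^sup>2 * t) (\<lambda>y. f (y /\<^sub>R k)) x = heat t f (x /\<^sub>R k)"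
proof (cases "t = 0")
  case True then show ?thesis by (simp add: heat_def)
next
  case False
  with t have t: "0 < t" by simp
  have "heat (k\<^sup>2 * t) (\<lambda>y. f (y /\<^sub>R k)) x
      = (\<integral>\<^sup>+ y. ennreal (bm_density (k\<^sup>2 * t) (y - x)) * f (y /\<^sub>R k) \<partial>lborel)"
    using k t by (simp add: heat_def)
  also have "\<dots> = ennreal (\<bar>k\<bar> ^ DIM('a)) *
      (\<integral>\<^sup>+ y. ennreal (bm_density (k\<^sup>2 * t) (0 + k *\<^sub>R y - x)) * f ((0 + k *\<^sub>R y) /\<^sub>R k) \<partial>lborel)"
  proof (rule nn_integral_lborel_affine)
    show "(\<lambda>y. ennreal (bm_density (k\<^sup>2 * t) (y - x)) * f (y /\<^sub>R k)) \<in> borel_measurable borel" by measurable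
    show "k \<noteq> 0" using k by simp
  qed
  also have "\<dots> = (\<integral>\<^sup>+ y. ennreal (k ^ DIM('a)) * (ennreal (bm_density (k\<^sup>2 * t) (k *\<^sub>R y - x)) * f y) \<partial>lborel)"
    using k by (subst nn_integral_cmult) auto
  also have "\<dots> = (\<integral>\<^sup>+ y. ennreal (bm_density t (y - x /\<^sub>R k)) * f y \<partial>lborel)"
  proof (intro nn_integral_cong)
    fix y
    have "k *\<^sub>R y - x = k *\<^sub>R (y - x /\<^sub>R k)" using k by (simp add: scaleR_diff_right)
    then show "ennreal (k ^ DIM('a)) * (ennreal (bm_density (k\<^sup>2 * t) (k *\<^sub>R y - x)) * f y)
        = ennreal (bm_density t (y - x /\<^sub>R k)) * f y"
      using k bm_density_scale[OF k t, of "y - x /\<^sub>R k"]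
      by (simp add: mult.assoc[symmetric] ennreal_mult[symmetric])
  qed
  finally show ?thesis using t by (simp add: heat_def)
qed

lemma bm_fun_scale:
  fixes f :: "'a::euclidean_space \<Rightarrow> real"
  assumes "0 < k" "0 \<le> t" and [measurable]: "f \<in> borel_measurable borel" and nn: "\<And>y. 0 \<le> f y"
  shows "bm_fun (k\<^sup>2 * t) (\<lambda>y. f (y /\<^sub>R k)) x = bm_fun t f (x /\<^sub>R k)"
  using heat_scale[OF assms(1,2), of "\<lambda>y. ennreal (f y)" x] by (simp add: bm_fun_eq_enn2real_heat nn)

lemma sets_rescale [simp]: "sets (rescale k \<nu>) = sets borel"
  by (simp add: rescale_def)

lemma rescale_eqI:
  assumes "0 < k" "\<nu> \<in> M_tem" "\<mu> \<in> M_tem"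
    and "\<And>B. B \<in> sets borel \<Longrightarrow>
      ennreal (k powr (- real DIM('a))) * emeasure \<nu> ((\<lambda>x. k *\<^sub>R x) ` B) = emeasure \<mu> (B :: 'a::euclidean_space set)"
  shows "rescale k \<nu> = \<mu>"
  using assms by (intro measure_eqI) (auto simp: sets_M_tem emeasure_rescale)

lemma nn_integral_rescale:
  fixes \<nu> :: "'a::euclidean_space measure"
  assumes sn: "sets \<nu> = sets borel" and [measurable]: "f \<in> borel_measurable borel"
  shows "(\<integral>\<^sup>+ x. f x \<partial>rescale k \<nu>) = ennreal (k powr (- real DIM('a))) * (\<integral>\<^sup>+ x. f (x /\<^sub>R k) \<partial>\<nu>)"
proof -
  note [measurable_cong] = sn
  show ?thesis unfolding rescale_def
    by (subst nn_integral_scale_measure) (auto simp: nn_integral_distr)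
qed

lemma pairing_rescale:
  fixes \<nu> :: "'a::euclidean_space measure"
  assumes sn: "sets \<nu> = sets borel" and [measurable]: "f \<in> borel_measurable borel" and nn: "\<And>x. 0 \<le> f x"
  shows "pairing (rescale k \<nu>) f = k powr (- real DIM('a)) * pairing \<nu> (\<lambda>x. f (x /\<^sub>R k))"
proof -
  note [measurable_cong] = sn
  have "pairing (rescale k \<nu>) f = enn2real (\<integral>\<^sup>+ x. ennreal (f x) \<partial>rescale k \<nu>)"
    unfolding pairing_def by (rule integral_eq_nn_integral) (auto simp: nn cong: measurable_cong_sets)
  also have "\<dots> = enn2real (ennreal (k powr (- real DIM('a))) * (\<integral>\<^sup>+ x. ennreal (f (x /\<^sub>R k)) \<partial>\<nu>))"
    by (subst nn_integral_rescale[OF sn]) auto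
  also have "\<dots> = k powr (- real DIM('a)) * enn2real (\<integral>\<^sup>+ x. ennreal (f (x /\<^sub>R k)) \<partial>\<nu>)"
    by (simp add: enn2real_mult)
  also have "enn2real (\<integral>\<^sup>+ x. ennreal (f (x /\<^sub>R k)) \<partial>\<nu>) = pairing \<nu> (\<lambda>x. f (x /\<^sub>R k))"
    unfolding pairing_def by (rule integral_eq_nn_integral[symmetric]) (auto simp: nn)
  finally show ?thesis .
qed

lemma rescale_in_M_tem:
  fixes \<nu> :: "'a::euclidean_space measure"
  assumes \<nu>: "\<nu> \<in> M_tem" and k: "0 < k"
  shows "rescale k \<nu> \<in> M_tem"
proof -
  have w: "exp_weight l (x /\<^sub>R k) = exp_weight (l / k) x" for l and x :: 'a
    using k by (simp add: exp_weight_def divide_inverse mult_ac)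
  have "(\<integral>\<^sup>+ x. ennreal (exp_weight l x) \<partial>rescale k \<nu>) < \<infinity>" if "0 < l" for l
  proof -
    have "(\<integral>\<^sup>+ x. ennreal (exp_weight l x) \<partial>rescale k \<nu>)
        = ennreal (k powr (- real DIM('a))) * (\<integral>\<^sup>+ x. ennreal (exp_weight l (x /\<^sub>R k)) \<partial>\<nu>)"
      by (rule nn_integral_rescale[OF sets_M_tem[OF \<nu>]]) measurable
    also have "\<dots> = ennreal (k powr (- real DIM('a))) * (\<integral>\<^sup>+ x. ennreal (exp_weight (l / k) x) \<partial>\<nu>)"
      by (simp only: w)
    also have "\<dots> < \<infinity>"
    proof -
      have "(\<integral>\<^sup>+ x. ennreal (exp_weight (l / k) x) \<partial>\<nu>) < \<infinity>" using \<nu> k that by (simp add: M_tem_def)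
      then show ?thesis by (simp add: ennreal_mult_less_top)
    qed
    finally show ?thesis .
  qed
  then show ?thesis by (simp add: M_tem_def)
qed

lemma sets_bm_measure: "\<mu> \<in> M_tem \<Longrightarrow> sets (bm_measure t \<mu>) = sets borel"
  by (simp add: bm_measure_def sets_M_tem)

text \<open>Duality \<open>\<langle>S\<^sub>t \<mu>, f\<rangle> = \<langle>\<mu>, S\<^sub>t f\<rangle>\<close>, which is Tonelli for the symmetric density.\<close>

lemma nn_integral_bm_measure:
  fixes \<mu> :: "'a::euclidean_space measure"
  assumes \<mu>: "\<mu> \<in> M_tem" and [measurable]: "f \<in> borel_measurable borel"
  shows "(\<integral>\<^sup>+ x. f x \<partial>bm_measure t \<mu>) = (\<integral>\<^sup>+ y. heat t f y \<partial>\<mu>)"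
proof (cases "t = 0")
  case True then show ?thesis by (simp add: bm_measure_def heat_def)
next
  case False
  interpret M: sigma_finite_measure \<mu> by (rule sigma_finite_M_tem[OF \<mu>])
  interpret pair_sigma_finite \<mu> lborel ..
  note [measurable_cong] = sets_M_tem[OF \<mu>]
  have "(\<integral>\<^sup>+ x. f x \<partial>bm_measure t \<mu>) = (\<integral>\<^sup>+ x. (\<integral>\<^sup>+ y. ennreal (bm_density t (x - y)) \<partial>\<mu>) * f x \<partial>lborel)"
    using False by (simp add: bm_measure_def nn_integral_density)
  also have "\<dots> = (\<integral>\<^sup>+ x. (\<integral>\<^sup>+ y. ennreal (bm_density t (x - y)) * f x \<partial>\<mu>) \<partial>lborel)"
    by (intro nn_integral_cong nn_integral_multc[symmetric]) measurable
  also have "\<dots> = (\<integral>\<^sup>+ y. (\<integral>\<^sup>+ x. ennreal (bm_density t (x - y)) * f x \<partial>lborel) \<partial>\<mu>)"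
    by (rule Fubini') measurable
  finally show ?thesis using False by (simp add: heat_def)
qed

lemma
  fixes \<mu> :: "'a::euclidean_space measure"
  assumes \<mu>: "\<mu> \<in> M_tem" and t: "0 \<le> t" and \<phi>: "\<phi> \<in> C_exp_nonneg"
  shows pairing_bm_measure: "pairing (bm_measure t \<mu>) \<phi> = pairing \<mu> (bm_fun t \<phi>)"
    and integrable_bm_measure: "integrable (bm_measure t \<mu>) \<phi>"
proof -
  have C: "\<phi> \<in> C_exp" and nn: "\<And>x. 0 \<le> \<phi> x" using \<phi> by (auto simp: C_exp_nonneg_def)
  note [measurable] = C_exp_borel[OF C] and [measurable_cong] = sets_bm_measure[OF \<mu>] sets_M_tem[OF \<mu>]
  obtain A l where A: "0 \<le> A" "0 < l" and b: "\<And>x. \<bar>\<phi> x\<bar> \<le> A * exp_weight l x" using C_exp_bound[OF C] by blast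
  have le: "\<phi> x \<le> A * exp_weight l x" for x using b[of x] by simp
  note bm = bm_fun_exp_weight_le[OF A(1) less_imp_le[OF A(2)] C_exp_borel[OF C] nn le t order_refl]
  have "(\<integral>\<^sup>+ y. heat t (\<lambda>y. ennreal (\<phi> y)) y \<partial>\<mu>) = (\<integral>\<^sup>+ y. ennreal (bm_fun t \<phi> y) \<partial>\<mu>)"
    by (simp add: bm)
  then have eq: "(\<integral>\<^sup>+ x. ennreal (\<phi> x) \<partial>bm_measure t \<mu>) = (\<integral>\<^sup>+ y. ennreal (bm_fun t \<phi> y) \<partial>\<mu>)"
    by (simp add: nn_integral_bm_measure[OF \<mu>])
  have bm_meas [measurable]: "bm_fun t \<phi> \<in> borel_measurable borel" by (rule borel_measurable_bm_fun) (auto simp: nn)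
  have int: "integrable \<mu> (bm_fun t \<phi>)"
    by (rule integrable_M_tem[OF \<mu> bm_meas A(2)]) (use bm in \<open>simp add: abs_of_nonneg\<close>)
  show "integrable (bm_measure t \<mu>) \<phi>"
  proof (rule integrableI_bounded)
    have "(\<integral>\<^sup>+ x. ennreal (norm (\<phi> x)) \<partial>bm_measure t \<mu>) = (\<integral>\<^sup>+ y. ennreal (norm (bm_fun t \<phi> y)) \<partial>\<mu>)"
      using eq by (simp add: nn bm abs_of_nonneg)
    then show "(\<integral>\<^sup>+ x. ennreal (norm (\<phi> x)) \<partial>bm_measure t \<mu>) < \<infinity>"
      using int by (simp add: integrable_iff_bounded)
  qed measurable
  have "pairing (bm_measure t \<mu>) \<phi> = enn2real (\<integral>\<^sup>+ x. ennreal (\<phi> x) \<partial>bm_measure t \<mu>)"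
    unfolding pairing_def by (rule integral_eq_nn_integral) (auto simp: nn)
  also have "\<dots> = pairing \<mu> (bm_fun t \<phi>)"
    unfolding eq pairing_def by (rule integral_eq_nn_integral[symmetric]) (auto simp: bm)
  finally show "pairing (bm_measure t \<mu>) \<phi> = pairing \<mu> (bm_fun t \<phi>)" .
qed

section \<open>Convergence in law\<close>

text \<open>The bookkeeping of powers of \<open>k\<close>: about \<open>k\<^sup>2\<close> time steps, total mass of order \<open>k\<^sup>d\<close> seen by a test
  function of width \<open>k\<close>, and loss per step and unit mass of order \<open>A\<^sup>1\<^sup>+\<^sup>\<gamma>\<close>, where \<open>A\<close> is the height
  \<open>k\<^sup>\<kappa>\<^sup>-\<^sup>d\<close> of the test function.\<close>

lemma deviation_rate:
  fixes P :: "'a::euclidean_space measure measure" and \<mu>s :: "real \<Rightarrow> 'a measure"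
  assumes P: "stable_random_measure_law \<gamma> P" and Q: "catalytic_sbm \<rho> P Q" and \<gamma>: "0 < \<gamma>" and \<rho>: "0 \<le> \<rho>"
    and \<mu>: "\<mu> \<in> M_tem" and \<mu>s: "\<And>k. 0 < k \<Longrightarrow> \<mu>s k \<in> M_tem" "\<And>k. 0 < k \<Longrightarrow> rescale k (\<mu>s k) = \<mu>"
    and t: "0 \<le> t" and \<phi>: "\<phi> \<in> C_exp_nonneg" and \<epsilon>: "0 < \<epsilon>"
  obtains K k0 where "\<And>k. k0 \<le> k \<Longrightarrow>
    emeasure (annealed_law P Q (\<mu>s k)) {w \<in> paths. \<epsilon> \<le>
      \<bar>k powr \<kappa> * (pairing (scaled_process k w t) \<phi> - pairing (bm_measure t \<mu>) \<phi>)\<bar>}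
    \<le> ennreal (K * k powr (2 + real DIM('a) + (1 + \<gamma>) * (\<kappa> - real DIM('a))))"
proof -
  let ?d = "real DIM('a)"
  have C: "\<phi> \<in> C_exp" and nn: "\<And>x. 0 \<le> \<phi> x" using \<phi> by (auto simp: C_exp_nonneg_def)
  note [measurable] = C_exp_borel[OF C]
  obtain A l where A: "0 \<le> A" and l: "0 < l" and \<phi>_le: "\<And>x. \<bar>\<phi> x\<bar> \<le> A * exp_weight l x"
    using C_exp_bound[OF C] by blast
  define H where "H = heat_bound TYPE('a) (l\<^sup>2 * t)"
  have H: "0 \<le> H" by (simp add: H_def)
  define c where "c = exp 1 * heat_bound TYPE('a) 4 * \<rho>"
  have c: "0 \<le> c" using \<rho> by (simp add: c_def)
  define S where "S = stable_const TYPE('a) \<gamma>"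
  have S: "0 \<le> S" by (simp add: S_def)
  define I where "I = enn2real (\<integral>\<^sup>+ x. ennreal (exp_weight l x) \<partial>\<mu>)"
  have "(\<integral>\<^sup>+ x. ennreal (exp_weight l x) \<partial>\<mu>) < \<infinity>" using \<mu> l by (simp add: M_tem_def)
  then have I: "(\<integral>\<^sup>+ x. ennreal (exp_weight l x) \<partial>\<mu>) = ennreal I" "0 \<le> I" by (auto simp: I_def)
  define a where "a = 2 / (1 - exp (- \<epsilon>))\<^sup>2"
  have a: "0 \<le> a" by (simp add: a_def)
  define K where "K = a * (2 * (c * (2 * A * H)) powr \<gamma> * S * (2 * A * H) * H) * I * (t + 2)"
  show thesis
  proof (rule that[of "max 1 (2 * l)" K])
    fix k assume "max 1 (2 * l) \<le> k"
    then have k: "1 \<le> k" "2 * l \<le> k" "0 < k" by auto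
    \<comment> \<open>The deviation at scale \<open>k\<close> is that of the unscaled process at time \<open>?T\<close> tested against \<open>?\<psi>\<close>, whose height is
      of order \<open>?A\<close> and whose decay rate is \<open>?l\<close>. The heat bound at time \<open>?T\<close> then does not depend on \<open>k\<close>, as
      \<open>?l\<^sup>2 * ?T = l\<^sup>2 * t\<close>. The summand 1 in \<open>?N\<close> makes it positive when \<open>t = 0\<close>.\<close>
    let ?\<psi> = "\<lambda>x. (k powr \<kappa> * k powr (- ?d)) * \<phi> (x /\<^sub>R k)"
    let ?T = "k\<^sup>2 * t" and ?N = "nat \<lceil>k\<^sup>2 * t\<rceil> + 1" and ?A = "k powr (\<kappa> - ?d) * A" and ?l = "l / k"
    have T: "0 \<le> ?T" using t by simp
    have \<psi>: "?\<psi> \<in> C_exp_nonneg"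
      using C_exp_mult[OF C_exp_dilate[OF C k(3)], of "k powr \<kappa> * k powr (- ?d)"] nn by (simp add: C_exp_nonneg_def)
    have \<psi>_le: "?\<psi> x \<le> ?A * exp_weight ?l x" for x
    proof -
      have "\<phi> (x /\<^sub>R k) \<le> A * exp_weight ?l x"
        using \<phi>_le[of "x /\<^sub>R k"] nn k by (simp add: exp_weight_def divide_inverse mult_ac)
      then show ?thesis by (simp add: powr_add[symmetric] mult.assoc mult_left_mono)
    qed
    have lT: "?l\<^sup>2 * ?T = l\<^sup>2 * t" using k by (simp add: power_divide)
    have N: "?T \<le> real ?N" "real ?N \<le> (t + 2) * k\<^sup>2" "0 < ?N"
    proof -
      have N': "real ?N = of_int \<lceil>?T\<rceil> + 1" using T by simp
      show "?T \<le> real ?N" unfolding N' by linarith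
      have "real ?N \<le> ?T + 2" unfolding N' by linarith
      also have "\<dots> \<le> ?T + 2 * k\<^sup>2" using one_le_power[OF k(1), of 2] by linarith
      finally show "real ?N \<le> (t + 2) * k\<^sup>2" by (simp add: algebra_simps)
    qed simp
    have pairing_bm: "pairing (\<mu>s k) (bm_fun ?T ?\<psi>) = k powr \<kappa> * pairing (bm_measure t \<mu>) \<phi>"
    proof -
      have bm0: "0 \<le> bm_fun t \<phi> x" for x by (simp add: bm_fun_eq_enn2real_heat nn)
      have "pairing (\<mu>s k) (bm_fun ?T ?\<psi>) = (k powr \<kappa> * k powr (- ?d)) * pairing (\<mu>s k) (\<lambda>x. bm_fun t \<phi> (x /\<^sub>R k))"
        using k t nn by (simp add: bm_fun_cmult[abs_def] bm_fun_scale pairing_cmult)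
      also have "\<dots> = k powr \<kappa> * pairing (rescale k (\<mu>s k)) (bm_fun t \<phi>)"
        using bm0 by (subst pairing_rescale[OF sets_M_tem[OF \<mu>s(1)[OF k(3)]] borel_measurable_bm_fun]) (auto simp: nn)
      also have "\<dots> = k powr \<kappa> * pairing (bm_measure t \<mu>) \<phi>"
        using \<mu>s(2)[OF k(3)] pairing_bm_measure[OF \<mu> t \<phi>] by simp
      finally show ?thesis .
    qed
    have pairing_X: "pairing (w ?T) ?\<psi> = k powr \<kappa> * pairing (scaled_process k w t) \<phi>" if w: "w \<in> paths" for w
      unfolding scaled_process_def
      by (subst pairing_rescale[OF sets_M_tem[OF M_tem_pathsD[OF w T]]]) (auto simp: nn pairing_cmult mult.assoc)
    have I_k: "(\<integral>\<^sup>+ x. ennreal (exp_weight ?l x) \<partial>\<mu>s k) = ennreal (k powr ?d * I)"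
    proof -
      have w: "exp_weight l (x /\<^sub>R k) = exp_weight ?l x" for x :: 'a
        using k by (simp add: exp_weight_def divide_inverse mult_ac)
      have "ennreal I = ennreal (k powr (- ?d)) * (\<integral>\<^sup>+ x. ennreal (exp_weight ?l x) \<partial>\<mu>s k)"
        using nn_integral_rescale[OF sets_M_tem[OF \<mu>s(1)[OF k(3)]], of "\<lambda>x. ennreal (exp_weight l x)" k]
        by (simp add: \<mu>s(2)[OF k(3)] I w)
      then have "ennreal (k powr ?d * I) = ennreal (k powr ?d) * (ennreal (k powr (- ?d)) * (\<integral>\<^sup>+ x. ennreal (exp_weight ?l x) \<partial>\<mu>s k))"
        by (simp add: ennreal_mult I)
      also have "\<dots> = ennreal (k powr ?d * k powr (- ?d)) * (\<integral>\<^sup>+ x. ennreal (exp_weight ?l x) \<partial>\<mu>s k)"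
        by (simp add: ennreal_mult mult.assoc)
      also have "k powr ?d * k powr (- ?d) = 1" using k by (simp add: powr_add[symmetric])
      finally show ?thesis by simp
    qed
    have "{w \<in> paths. \<epsilon> \<le> \<bar>k powr \<kappa> * (pairing (scaled_process k w t) \<phi> - pairing (bm_measure t \<mu>) \<phi>)\<bar>}
        = {w \<in> paths. \<epsilon> \<le> \<bar>pairing (w ?T) ?\<psi> - pairing (\<mu>s k) (bm_fun ?T ?\<psi>)\<bar>}"
      by (auto simp: pairing_bm pairing_X right_diff_distrib)
    then have "emeasure (annealed_law P Q (\<mu>s k)) {w \<in> paths. \<epsilon> \<le>
        \<bar>k powr \<kappa> * (pairing (scaled_process k w t) \<phi> - pairing (bm_measure t \<mu>) \<phi>)\<bar>}
      = emeasure (annealed_law P Q (\<mu>s k)) {w \<in> paths. \<epsilon> \<le> \<bar>pairing (w ?T) ?\<psi> - pairing (\<mu>s k) (bm_fun ?T ?\<psi>)\<bar>}"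
      by simp
    also have "\<dots> \<le> ennreal a * (ennreal (2 * real ?N * (c * (2 * ?A * H)) powr \<gamma> * S * (2 * ?A * H) * H)
        * (\<integral>\<^sup>+ x. ennreal (exp_weight ?l x) \<partial>\<mu>s k))"
      unfolding a_def c_def S_def H_def lT[symmetric]
      using k l A by (intro annealed_deviation_le[OF P Q \<mu>s(1)[OF k(3)] \<gamma> \<psi> \<psi>_le \<rho> _ _ _ T N(3,1) \<epsilon>]) auto
    also have "\<dots> = ennreal (a * (2 * real ?N * (c * (2 * ?A * H)) powr \<gamma> * S * (2 * ?A * H) * H * (k powr ?d * I)))"
      unfolding I_k using a S A H I(2) by (simp add: ennreal_mult[symmetric])
    also have "\<dots> \<le> ennreal (K * k powr (2 + ?d + (1 + \<gamma>) * (\<kappa> - ?d)))"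
    proof (rule ennreal_leI)
      let ?R = "a * (2 * (c * (2 * A * H)) powr \<gamma> * S * (2 * A * H) * H) * I"
      have R: "0 \<le> ?R" using a S A H I(2) by simp
      have "(c * (2 * ?A * H)) powr \<gamma> = (k powr (\<kappa> - ?d) * (c * (2 * A * H))) powr \<gamma>"
        by (simp add: mult_ac)
      also have "\<dots> = k powr ((\<kappa> - ?d) * \<gamma>) * (c * (2 * A * H)) powr \<gamma>"
        using c A H by (simp add: powr_mult powr_powr)
      finally have g: "(c * (2 * ?A * H)) powr \<gamma> = k powr ((\<kappa> - ?d) * \<gamma>) * (c * (2 * A * H)) powr \<gamma>" .
      have "a * (2 * real ?N * (c * (2 * ?A * H)) powr \<gamma> * S * (2 * ?A * H) * H * (k powr ?d * I))
        = real ?N * (?R * (k powr ((\<kappa> - ?d) * \<gamma>) * k powr (\<kappa> - ?d) * k powr ?d))"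
        unfolding g by (simp only: mult_ac)
      also have "\<dots> \<le> ((t + 2) * k\<^sup>2) * (?R * (k powr ((\<kappa> - ?d) * \<gamma>) * k powr (\<kappa> - ?d) * k powr ?d))"
        using N(2) R by (intro mult_right_mono) auto
      also have "\<dots> = K * (k powr 2 * k powr ((\<kappa> - ?d) * \<gamma>) * k powr (\<kappa> - ?d) * k powr ?d)"
        unfolding K_def using k by (simp only: powr_numeral mult_ac)
      also have "\<dots> = K * k powr (2 + ?d + (1 + \<gamma>) * (\<kappa> - ?d))"
        unfolding powr_add[symmetric] by (simp add: algebra_simps)
      finally show "a * (2 * real ?N * (c * (2 * ?A * H)) powr \<gamma> * S * (2 * ?A * H) * H * (k powr ?d * I))
        \<le> K * k powr (2 + ?d + (1 + \<gamma>) * (\<kappa> - ?d))" .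
    qed
    finally show "emeasure (annealed_law P Q (\<mu>s k)) {w \<in> paths. \<epsilon> \<le>
        \<bar>k powr \<kappa> * (pairing (scaled_process k w t) \<phi> - pairing (bm_measure t \<mu>) \<phi>)\<bar>}
      \<le> ennreal (K * k powr (2 + ?d + (1 + \<gamma>) * (\<kappa> - ?d)))" .
  qed
qed

text \<open>The exponent in the rate is negative exactly for \<open>\<kappa>\<close> below the critical value.\<close>

lemma deviation_tendsto_0:
  fixes P :: "'a::euclidean_space measure measure" and \<mu>s :: "real \<Rightarrow> 'a measure" and ks :: "nat \<Rightarrow> real"
  assumes P: "stable_random_measure_law \<gamma> P" and Q: "catalytic_sbm \<rho> P Q" and \<gamma>: "0 < \<gamma>" and \<rho>: "0 \<le> \<rho>"
    and \<mu>: "\<mu> \<in> M_tem" and \<mu>s: "\<And>k. 0 < k \<Longrightarrow> \<mu>s k \<in> M_tem" "\<And>k. 0 < k \<Longrightarrow> rescale k (\<mu>s k) = \<mu>"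
    and t: "0 \<le> t" and \<phi>: "\<phi> \<in> C_exp_nonneg" and \<epsilon>: "0 < \<epsilon>"
    and \<kappa>: "\<kappa> < kappa_crit \<gamma> DIM('a)" and ks: "filterlim ks at_top sequentially"
  shows "(\<lambda>n. emeasure (annealed_law P Q (\<mu>s (ks n))) {w \<in> paths. \<epsilon> \<le>
      \<bar>ks n powr \<kappa> * (pairing (scaled_process (ks n) w t) \<phi> - pairing (bm_measure t \<mu>) \<phi>)\<bar>}) \<longlonglongrightarrow> 0"
proof -
  let ?p = "2 + real DIM('a) + (1 + \<gamma>) * (\<kappa> - real DIM('a))"
  have p: "?p < 0"
    using \<kappa> \<gamma> by (simp add: kappa_crit_def pos_less_divide_eq algebra_simps)
  obtain K k0 where K: "\<And>k. k0 \<le> k \<Longrightarrow>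
    emeasure (annealed_law P Q (\<mu>s k)) {w \<in> paths. \<epsilon> \<le>
      \<bar>k powr \<kappa> * (pairing (scaled_process k w t) \<phi> - pairing (bm_measure t \<mu>) \<phi>)\<bar>} \<le> ennreal (K * k powr ?p)"
    using deviation_rate[OF P Q \<gamma> \<rho> \<mu> \<mu>s t \<phi> \<epsilon>] by blast
  have "(\<lambda>n. K * ks n powr ?p) \<longlonglongrightarrow> K * 0"
    by (intro tendsto_mult tendsto_const tendsto_neg_powr[OF p ks])
  then have lim: "(\<lambda>n. ennreal (K * ks n powr ?p)) \<longlonglongrightarrow> 0"
    using tendsto_ennrealI[of "\<lambda>n. K * ks n powr ?p" 0] by simp
  have "\<forall>\<^sub>F n in sequentially. k0 \<le> ks n" using ks by (simp add: filterlim_at_top)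
  then have le: "\<forall>\<^sub>F n in sequentially. emeasure (annealed_law P Q (\<mu>s (ks n))) {w \<in> paths. \<epsilon> \<le>
      \<bar>ks n powr \<kappa> * (pairing (scaled_process (ks n) w t) \<phi> - pairing (bm_measure t \<mu>) \<phi>)\<bar>}
      \<le> ennreal (K * ks n powr ?p)"
    by (rule eventually_mono) (rule K)
  show ?thesis
    by (rule tendsto_sandwich[OF always_eventually le tendsto_const lim]) simp
qed

lemma weak_conv_m_return_0:
  fixes X :: "nat \<Rightarrow> 'b \<Rightarrow> real"
  assumes M: "\<And>n. prob_space (M n)" and X [measurable]: "\<And>n. X n \<in> borel_measurable (M n)"
    and conv: "\<And>\<epsilon>. 0 < \<epsilon> \<Longrightarrow> (\<lambda>n. emeasure (M n) {w \<in> space (M n). \<epsilon> \<le> \<bar>X n w\<bar>}) \<longlonglongrightarrow> 0"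
  shows "weak_conv_m (\<lambda>n. distr (M n) borel (X n)) (return borel 0)"
  unfolding weak_conv_m_def weak_conv_def
proof (intro allI impI)
  fix x assume cont: "isCont (cdf (return borel 0)) x"
  have cdf0: "cdf (return borel 0) y = (if 0 \<le> y then 1 else 0)" for y :: real
    by (simp add: cdf_def measure_return indicator_def)
  have cdfX: "cdf (distr (M n) borel (X n)) x = measure (M n) {w \<in> space (M n). X n w \<le> x}" for n
  proof -
    have "X n -` {..x} \<inter> space (M n) = {w \<in> space (M n). X n w \<le> x}" by blast
    then show ?thesis unfolding cdf_def by (subst measure_distr) simp_all
  qed
  have conv': "(\<lambda>n. measure (M n) {w \<in> space (M n). \<epsilon> \<le> \<bar>X n w\<bar>}) \<longlonglongrightarrow> 0" if "0 < \<epsilon>" for \<epsilon>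
    using tendsto_enn2real[of _ 0 sequentially] conv[OF that] unfolding measure_def by simp
  \<comment> \<open>The limit distribution function jumps at 0, so 0 is not among the points to be considered.\<close>
  have "x \<noteq> 0"
  proof
    assume "x = 0"
    have "(\<lambda>n. - inverse (real (Suc n))) \<longlonglongrightarrow> x"
      using tendsto_minus[OF LIMSEQ_inverse_real_of_nat] \<open>x = 0\<close> by simp
    then have "(\<lambda>n. cdf (return borel 0) (- inverse (real (Suc n)))) \<longlonglongrightarrow> cdf (return borel 0) x"
      by (rule isCont_tendsto_compose[OF cont])
    then have "(\<lambda>n::nat. 0::real) \<longlonglongrightarrow> 1"
      using \<open>x = 0\<close> by (simp add: cdf0 del: of_nat_Suc)
    then show False by (simp add: LIMSEQ_const_iff)
  qed
  then consider "x < 0" | "0 < x" by linarith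
  then show "(\<lambda>n. cdf (distr (M n) borel (X n)) x) \<longlonglongrightarrow> cdf (return borel 0) x"
  proof cases
    case 1
    have "(\<lambda>n. measure (M n) {w \<in> space (M n). X n w \<le> x}) \<longlonglongrightarrow> 0"
    proof (rule tendsto_sandwich[OF _ _ tendsto_const conv'[of "- x"]])
      show "\<forall>\<^sub>F n in sequentially. measure (M n) {w \<in> space (M n). X n w \<le> x}
          \<le> measure (M n) {w \<in> space (M n). - x \<le> \<bar>X n w\<bar>}"
      proof (intro always_eventually allI)
        fix n
        interpret prob_space "M n" by (rule M)
        show "measure (M n) {w \<in> space (M n). X n w \<le> x} \<le> measure (M n) {w \<in> space (M n). - x \<le> \<bar>X n w\<bar>}"
          by (intro finite_measure_mono) auto
      qed
    qed (use 1 in auto)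
    then show ?thesis using 1 by (simp add: cdfX cdf0)
  next
    case 2
    have "(\<lambda>n. measure (M n) {w \<in> space (M n). X n w \<le> x}) \<longlonglongrightarrow> 1"
    proof (rule tendsto_sandwich[OF _ _ _ tendsto_const])
      show "(\<lambda>n. 1 - measure (M n) {w \<in> space (M n). x \<le> \<bar>X n w\<bar>}) \<longlonglongrightarrow> 1"
        using tendsto_diff[OF tendsto_const[of "1::real"] conv'[OF 2]] by simp
      show "\<forall>\<^sub>F n in sequentially. 1 - measure (M n) {w \<in> space (M n). x \<le> \<bar>X n w\<bar>}
          \<le> measure (M n) {w \<in> space (M n). X n w \<le> x}"
      proof (intro always_eventually allI)
        fix n
        interpret prob_space "M n" by (rule M)
        have "1 = prob (space (M n))" by (simp add: prob_space)
        also have "\<dots> \<le> prob ({w \<in> space (M n). X n w \<le> x} \<union> {w \<in> space (M n). x \<le> \<bar>X n w\<bar>})"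
          by (intro finite_measure_mono) auto
        also have "\<dots> \<le> prob {w \<in> space (M n). X n w \<le> x} + prob {w \<in> space (M n). x \<le> \<bar>X n w\<bar>}"
          by (intro measure_Un_le) auto
        finally show "1 - measure (M n) {w \<in> space (M n). x \<le> \<bar>X n w\<bar>}
          \<le> measure (M n) {w \<in> space (M n). X n w \<le> x}" by simp
      qed
      show "\<forall>\<^sub>F n in sequentially. measure (M n) {w \<in> space (M n). X n w \<le> x} \<le> 1"
        using M by (intro always_eventually allI) (simp add: prob_space.prob_le_1)
    qed
    then show ?thesis using 2 by (simp add: cdfX cdf0)
  qed
qed

theorem theorem1:
  fixes \<gamma> \<rho> \<kappa> :: real
    and P :: "'a::euclidean_space measure measure"
    and Q :: "'a measure \<Rightarrow> 'a measure \<Rightarrow> (real \<Rightarrow> 'a measure) measure"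
    and \<mu> :: "'a measure"
    and \<mu>s :: "real \<Rightarrow> 'a measure"
  assumes "0 < \<gamma>" and "\<gamma> < 1"
    and "0 < \<rho>"
    and "real DIM('a) > 2 / \<gamma>"
    and "stable_random_measure_law \<gamma> P"
    and "catalytic_sbm \<rho> P Q"
    and "\<mu> \<in> M_tem"
    and "\<And>k. 0 < k \<Longrightarrow> \<mu>s k \<in> M_tem"
    and "\<And>k B. 0 < k \<Longrightarrow> B \<in> sets borel \<Longrightarrow>
      ennreal (k powr (- real DIM('a))) * emeasure (\<mu>s k) ((\<lambda>x. k *\<^sub>R x) ` B) = emeasure \<mu> B"
    and "0 \<le> \<kappa>" and "\<kappa> < kappa_crit \<gamma> DIM('a)"
  shows "\<forall>t\<ge>0. \<forall>\<phi>\<in>C_exp. \<forall>ks :: nat \<Rightarrow> real.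
    (\<forall>n. 0 < ks n) \<longrightarrow> filterlim ks at_top sequentially \<longrightarrow>
    weak_conv_m
      (\<lambda>n. distr (annealed_law P Q (\<mu>s (ks n))) borel
        (\<lambda>w. ks n powr \<kappa> *
          (pairing (scaled_process (ks n) w t) \<phi> - pairing (bm_measure t \<mu>) \<phi>)))
      (return borel 0)"
proof (intro allI ballI impI)
  fix t :: real and \<phi> :: "'a \<Rightarrow> real" and ks :: "nat \<Rightarrow> real"
  assume t: "0 \<le> t" and \<phi>: "\<phi> \<in> C_exp" and pos: "\<forall>n. 0 < ks n" and ks: "filterlim ks at_top sequentially"
  note P = assms(5) and Q = assms(6) and \<mu> = assms(7) and \<mu>s = assms(8)
  have k: "0 < ks n" for n using pos by simp
  have resc: "rescale k (\<mu>s k) = \<mu>" if "0 < k" for k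
    by (rule rescale_eqI[OF that \<mu>s[OF that] \<mu> assms(9)[OF that]])
  have pP: "prob_space P" using P by (simp add: stable_random_measure_law_def)
  have A: "prob_space (annealed_law P Q (\<mu>s (ks n)))" "sets (annealed_law P Q (\<mu>s (ks n))) = sets path_space" for n
  proof -
    have "(\<lambda>G. Q G (\<mu>s (ks n))) \<in> P \<rightarrow>\<^sub>M prob_algebra path_space"
      using Q \<mu>s[OF k] by (auto simp: catalytic_sbm_def)
    moreover have "P \<in> space (prob_algebra P)" using pP by (simp add: space_prob_algebra)
    ultimately show "prob_space (annealed_law P Q (\<mu>s (ks n)))" "sets (annealed_law P Q (\<mu>s (ks n))) = sets path_space"
      unfolding annealed_law_def by (rule prob_space_bind'[rotated], rule sets_bind'[rotated])
  qed
  have spA: "space (annealed_law P Q (\<mu>s (ks n))) = paths" for n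
    using sets_eq_imp_space_eq[OF A(2)] by (simp add: space_path_space)
  \<comment> \<open>The rate is available for nonnegative test functions; the general case follows by linearity.\<close>
  define dev where "dev f n w = ks n powr \<kappa> * (pairing (scaled_process (ks n) w t) f - pairing (bm_measure t \<mu>) f)"
    for f :: "'a \<Rightarrow> real" and n w
  define pp where "pp = (\<lambda>x. max 0 (\<phi> x))"
  define np where "np = (\<lambda>x. max 0 (- \<phi> x))"
  have pp: "pp \<in> C_exp_nonneg" unfolding pp_def by (rule C_exp_max_0[OF \<phi>])
  have np: "np \<in> C_exp_nonneg" unfolding np_def using C_exp_max_0[OF C_exp_mult[OF \<phi>, of "-1"]] by simp
  have \<phi>_eq: "\<phi> = (\<lambda>x. pp x - np x)" by (auto simp: pp_def np_def max_def)
  have T: "0 \<le> (ks n)\<^sup>2 * t" for n using t by simp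
  have dev_meas: "dev f n \<in> borel_measurable (annealed_law P Q (\<mu>s (ks n)))" if f: "f \<in> C_exp_nonneg" for f n
  proof -
    have fC: "f \<in> C_exp" "\<And>x. 0 \<le> f x" using f by (auto simp: C_exp_nonneg_def)
    define h where "h w = ks n powr \<kappa> * (ks n powr (- real DIM('a)) * pairing (w ((ks n)\<^sup>2 * t)) (\<lambda>x. f (x /\<^sub>R ks n))
        - pairing (bm_measure t \<mu>) f)" for w
    note [measurable] = borel_measurable_path_pairing[OF T[of n] C_exp_dilate[OF fC(1) k[of n]]]
    have "h \<in> borel_measurable path_space" unfolding h_def by measurable
    then have "h \<in> borel_measurable (annealed_law P Q (\<mu>s (ks n)))"
      unfolding measurable_cong_sets[OF A(2) refl] .
    moreover have "dev f n w = h w" if w: "w \<in> space (annealed_law P Q (\<mu>s (ks n)))" for w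
      using w unfolding dev_def h_def scaled_process_def spA
      by (subst pairing_rescale[OF sets_M_tem[OF M_tem_pathsD[OF _ T]] C_exp_borel[OF fC(1)] fC(2)]) simp_all
    ultimately show ?thesis
      using measurable_cong[of "annealed_law P Q (\<mu>s (ks n))" "dev f n" h] by blast
  qed
  have dev_eq: "dev \<phi> n w = dev pp n w - dev np n w" if w: "w \<in> paths" for n w
  proof -
    have X: "scaled_process (ks n) w t \<in> M_tem"
      unfolding scaled_process_def by (rule rescale_in_M_tem[OF M_tem_pathsD[OF w T] k])
    have "pp \<in> C_exp" "np \<in> C_exp" using pp np by (auto simp: C_exp_nonneg_def)
    then have "pairing (scaled_process (ks n) w t) \<phi> = pairing (scaled_process (ks n) w t) pp - pairing (scaled_process (ks n) w t) np"
      unfolding pairing_def \<phi>_eq by (intro Bochner_Integration.integral_diff integrable_C_exp X)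
    moreover have "pairing (bm_measure t \<mu>) \<phi> = pairing (bm_measure t \<mu>) pp - pairing (bm_measure t \<mu>) np"
      unfolding pairing_def \<phi>_eq by (intro Bochner_Integration.integral_diff integrable_bm_measure \<mu> t pp np)
    ultimately show ?thesis unfolding dev_def by (simp only:) (simp add: algebra_simps)
  qed
  have conv: "(\<lambda>n. emeasure (annealed_law P Q (\<mu>s (ks n))) {w \<in> paths. \<epsilon> \<le> \<bar>dev f n w\<bar>}) \<longlonglongrightarrow> 0"
    if "f \<in> C_exp_nonneg" "0 < \<epsilon>" for f \<epsilon>
    unfolding dev_def using assms(1,3) by (intro deviation_tendsto_0[OF P Q _ _ \<mu> \<mu>s resc t that assms(11) ks]) auto
  have "weak_conv_m (\<lambda>n. distr (annealed_law P Q (\<mu>s (ks n))) borel (dev \<phi> n)) (return borel 0)"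
  proof (rule weak_conv_m_return_0[OF A(1)])
    fix n
    have "(\<lambda>w. dev pp n w - dev np n w) \<in> borel_measurable (annealed_law P Q (\<mu>s (ks n)))"
      by (intro borel_measurable_diff dev_meas pp np)
    then show "dev \<phi> n \<in> borel_measurable (annealed_law P Q (\<mu>s (ks n)))"
      using measurable_cong[of "annealed_law P Q (\<mu>s (ks n))" "dev \<phi> n" "\<lambda>w. dev pp n w - dev np n w"]
      by (simp add: spA dev_eq)
  next
    fix \<epsilon> :: real assume \<epsilon>: "0 < \<epsilon>"
    let ?E = "\<lambda>f \<epsilon> n. {w \<in> paths. \<epsilon> \<le> \<bar>dev f n w\<bar>}"
    have E: "?E f \<epsilon> n \<in> sets (annealed_law P Q (\<mu>s (ks n)))" if "f \<in> C_exp_nonneg" for f \<epsilon> n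
    proof -
      note [measurable] = dev_meas[OF that]
      have "{w \<in> space (annealed_law P Q (\<mu>s (ks n))). \<epsilon> \<le> \<bar>dev f n w\<bar>} \<in> sets (annealed_law P Q (\<mu>s (ks n)))" by measurable
      then show ?thesis by (simp add: spA)
    qed
    have le: "emeasure (annealed_law P Q (\<mu>s (ks n))) (?E \<phi> \<epsilon> n) \<le>
      emeasure (annealed_law P Q (\<mu>s (ks n))) (?E pp (\<epsilon> / 2) n) + emeasure (annealed_law P Q (\<mu>s (ks n))) (?E np (\<epsilon> / 2) n)" for n
    proof -
      have "?E \<phi> \<epsilon> n \<subseteq> ?E pp (\<epsilon> / 2) n \<union> ?E np (\<epsilon> / 2) n"
      proof
        fix w assume "w \<in> ?E \<phi> \<epsilon> n"
        then have w: "w \<in> paths" "\<epsilon> \<le> \<bar>dev \<phi> n w\<bar>" by simp_all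
        then have "\<epsilon> \<le> \<bar>dev pp n w - dev np n w\<bar>" by (simp add: dev_eq)
        then have "\<epsilon> / 2 \<le> \<bar>dev pp n w\<bar> \<or> \<epsilon> / 2 \<le> \<bar>dev np n w\<bar>" by linarith
        then show "w \<in> ?E pp (\<epsilon> / 2) n \<union> ?E np (\<epsilon> / 2) n" using w(1) by blast
      qed
      then have "emeasure (annealed_law P Q (\<mu>s (ks n))) (?E \<phi> \<epsilon> n) \<le>
          emeasure (annealed_law P Q (\<mu>s (ks n))) (?E pp (\<epsilon> / 2) n \<union> ?E np (\<epsilon> / 2) n)"
        by (intro emeasure_mono sets.Un E pp np)
      also have "\<dots> \<le> emeasure (annealed_law P Q (\<mu>s (ks n))) (?E pp (\<epsilon> / 2) n) + emeasure (annealed_law P Q (\<mu>s (ks n))) (?E np (\<epsilon> / 2) n)"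
        by (intro emeasure_subadditive E pp np)
      finally show ?thesis .
    qed
    have "(\<lambda>n. emeasure (annealed_law P Q (\<mu>s (ks n))) (?E pp (\<epsilon> / 2) n) + emeasure (annealed_law P Q (\<mu>s (ks n))) (?E np (\<epsilon> / 2) n)) \<longlonglongrightarrow> 0 + 0"
      using \<epsilon> by (intro tendsto_add conv pp np) auto
    then have lim: "(\<lambda>n. emeasure (annealed_law P Q (\<mu>s (ks n))) (?E pp (\<epsilon> / 2) n) + emeasure (annealed_law P Q (\<mu>s (ks n))) (?E np (\<epsilon> / 2) n)) \<longlonglongrightarrow> 0"
      by simp
    show "(\<lambda>n. emeasure (annealed_law P Q (\<mu>s (ks n))) {w \<in> space (annealed_law P Q (\<mu>s (ks n))). \<epsilon> \<le> \<bar>dev \<phi> n w\<bar>}) \<longlonglongrightarrow> 0"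
      unfolding spA
      by (rule tendsto_sandwich[OF _ always_eventually[OF allI[OF le]] tendsto_const lim]) simp
  qed
  then show "weak_conv_m
      (\<lambda>n. distr (annealed_law P Q (\<mu>s (ks n))) borel
        (\<lambda>w. ks n powr \<kappa> * (pairing (scaled_process (ks n) w t) \<phi> - pairing (bm_measure t \<mu>) \<phi>)))
      (return borel 0)"
    by (simp add: dev_def[abs_def])
qed

end
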